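(* Let $n\geq1$. If the number of critical points of a real $u\in\mathcal{H}_n$ (as a function on $\mathbb{S}^2$) is finite, then it does not exceed $2n^2$; in particular, this is true for a generic real $u\in\mathcal{H}_n$, i.e. a generic real $u\in\mathcal{H}_n$ has at most $2n^2$ critical points on $\mathbb{S}^2$.
   Context: $\mathcal{H}_n$ is the space of complex-valued harmonic homogeneous polynomials of degree $n$ on $\mathbb{R}^3$, also viewed as functions on the unit sphere $\mathbb{S}^2\subset\mathbb{R}^3$; $u\in\mathcal{H}_n$ is real if it takes real values on $\mathbb{R}^3$. Critical points of $u$ are the critical points of the restriction $u|_{\mathbb{S}^2}$. A property holds for generic real $u\in\mathcal{H}_n$ if it holds for all $u$ in an open dense subset of the real vector space of real elements of $\mathcal{H}_n$. *)

theory Defs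
  imports "HOL-Analysis.Analysis"
begin

definition homogeneous_polynomial :: "nat \<Rightarrow> (real ^ 3 \<Rightarrow> complex) \<Rightarrow> bool" where
  "homogeneous_polynomial n u \<longleftrightarrow>
     (\<exists>c :: nat \<Rightarrow> nat \<Rightarrow> nat \<Rightarrow> complex. \<forall>x.
        u x = (\<Sum>(i, j, k) \<in> {(i, j, k). i + j + k = n}.
                 c i j k * of_real (x $ 1 ^ i * x $ 2 ^ j * x $ 3 ^ k)))"

definition partial_derivative :: "3 \<Rightarrow> (real ^ 3 \<Rightarrow> complex) \<Rightarrow> real ^ 3 \<Rightarrow> complex" where
  "partial_derivative i u x = frechet_derivative u (at x) (axis i 1)"

definition laplacian :: "(real ^ 3 \<Rightarrow> complex) \<Rightarrow> real ^ 3 \<Rightarrow> complex" where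
  "laplacian u x = (\<Sum>i\<in>UNIV. partial_derivative i (partial_derivative i u) x)"

definition harmonic_polynomials :: "nat \<Rightarrow> (real ^ 3 \<Rightarrow> complex) set" where
  "harmonic_polynomials n = {u. homogeneous_polynomial n u \<and> (\<forall>x. laplacian u x = 0)}"

definition real_harmonic_polynomials :: "nat \<Rightarrow> (real ^ 3 \<Rightarrow> complex) set" where
  "real_harmonic_polynomials n = {u \<in> harmonic_polynomials n. \<forall>x. u x \<in> \<real>}"

text \<open>
  The tangent space of the unit sphere at \<open>p\<close> is the orthogonal complement of \<open>p\<close>, and the
  differential of the restriction of \<open>u\<close> to the sphere is the differential of \<open>u\<close> restricted
  to that tangent space. The definition is meant for functions differentiable on the whole
  space, such as polynomials.
\<close>

definition sphere_tangent_space :: "real ^ 3 \<Rightarrow> (real ^ 3) set" where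
  "sphere_tangent_space p = {v. v \<bullet> p = 0}"

definition sphere_critical_points :: "(real ^ 3 \<Rightarrow> complex) \<Rightarrow> (real ^ 3) set" where
  "sphere_critical_points u =
     {p \<in> sphere 0 1. \<forall>v \<in> sphere_tangent_space p. frechet_derivative u (at p) v = 0}"

text \<open>
  The real harmonic polynomials of degree \<open>n\<close> form a finite-dimensional real vector space, which
  carries exactly one Hausdorff vector space topology. It is obtained here as the subspace topology
  of the topology of pointwise convergence, the standard topology on a function type.
\<close>

definition holds_for_generic_real_harmonic ::
    "nat \<Rightarrow> ((real ^ 3 \<Rightarrow> complex) \<Rightarrow> bool) \<Rightarrow> bool" where
  "holds_for_generic_real_harmonic n P \<longleftrightarrow>
     (\<exists>U. openin (top_of_set (real_harmonic_polynomials n)) U \<and>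
          top_of_set (real_harmonic_polynomials n) closure_of U = real_harmonic_polynomials n \<and>
          (\<forall>u \<in> U. P u))"

end

theory Submission
  imports Defs "HOL-Probability.Distributions" "HOL-Computational_Algebra.Polynomial_Factorial"
    "HOL-Computational_Algebra.Field_as_Ring" "HOL-Computational_Algebra.Fundamental_Theorem_Algebra"
begin

text \<open>
  In an orthonormal frame with coordinates \<open>x\<^sub>1, x\<^sub>2, x\<^sub>3\<close> a point with \<open>x\<^sub>3 \<noteq> 0\<close> is critical for \<open>u\<close> iff
  the angular derivatives \<open>x\<^sub>i \<partial>\<^sub>3 u - x\<^sub>3 \<partial>\<^sub>i u\<close> with \<open>i = 1, 2\<close> vanish there. These are again harmonic of
  degree \<open>n\<close>, so in the affine chart \<open>x\<^sub>3 = 1\<close> one has to count the common zeros of two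
  polynomials \<open>F, G\<close> of degree at most \<open>n\<close>: if they are coprime, Bezout's bound gives \<open>n\<^sup>2\<close> of them, and each
  accounts for two antipodal critical points. If only finitely many points are critical, a frame
  can be chosen with \<open>x\<^sub>3 \<noteq> 0\<close> at all of them, and \<open>F\<close> and \<open>G\<close> are then coprime: a common factor of
  both signs has infinitely many zeros, and a nonconstant semidefinite one cannot
  divide a harmonic polynomial, which is orthogonal to all homogeneous polynomials of smaller degree.

  For the generic statement, consider the restrictions of \<open>F\<close> and \<open>G\<close> to the line \<open>x\<^sub>1 = 0\<close> as binary
  forms. To have no common zero on the complex projective line is an open condition,
  it forces the set of critical points to be finite, and it can be achieved by an arbitrarily small multiple
  of \<open>Im ((x\<^sub>2 + i x\<^sub>3) ^ n) + x\<^sub>1 * Re ((x\<^sub>2 + i x\<^sub>3) ^ (n - 1))\<close>.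
\<close>

section \<open>Bezout's bound in the affine plane\<close>

text \<open>The delicate point is coprimality. The zeros counted are real, and a common factor such
  as 1 + x^2 + y^2 has none, so finiteness of the critical set alone does not exclude a common
  factor. Harmonicity does, and this is what angular derivatives are chosen for: they describe
  critical points and stay inside the harmonic polynomials of degree n. For a generic u, finiteness
  itself has to be secured, by a condition on finitely many coefficients. Write u = a + x1 b + ...
  with forms a, b in x2, x3. On x1 = 0 the polynomial F depends only on a and G only on b. Hence the
  two summands of the perturbation: with z = y + i on the line x2 = y, x3 = 1, they contribute n Re
  (z^n) to F and Re (z^(n-1)) to G, and these two polynomials in y have no common zero, even for
  complex y.\<close>

lemma homogeneous_system_nontrivial_solution:
  fixes A :: "'e \<Rightarrow> 'v \<Rightarrow> real"
  assumes "finite E" "finite V" "card E < card V"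
  shows "\<exists>x. (\<exists>v\<in>V. x v \<noteq> 0) \<and> (\<forall>e\<in>E. (\<Sum>v\<in>V. A e v * x v) = 0)"
  using assms
proof (induction E arbitrary: V A rule: finite_induct)
  case empty
  then obtain v where "v \<in> V" by (metis all_not_in_conv card.empty less_irrefl)
  then show ?case by (intro exI[of _ "\<lambda>_. 1"]) auto
next
  case (insert e E)
  show ?case
  proof (cases "\<forall>v\<in>V. A e v = 0")
    case True
    obtain x where "\<exists>v\<in>V. x v \<noteq> 0" "\<forall>e\<in>E. (\<Sum>v\<in>V. A e v * x v) = 0"
      using insert.IH[of V A] insert.prems insert.hyps by auto
    then show ?thesis using True by (intro exI[of _ x]) auto
  next
    case False
    then obtain w where w: "w \<in> V" "A e w \<noteq> 0" by auto
    define W where "W = V - {w}"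
    have W: "finite W" "card E < card W" "V = insert w W" "w \<notin> W"
      using insert.prems insert.hyps w by (auto simp: W_def)
    \<comment> \<open>Equation \<open>e\<close> is solved for the unknown \<open>w\<close> and
      substituted into the others; \<open>y\<close> below undoes the substitution.\<close>
    define B where "B = (\<lambda>e' v. A e' v - A e' w * A e v / A e w)"
    obtain x where x: "\<exists>v\<in>W. x v \<noteq> 0" "\<forall>e\<in>E. (\<Sum>v\<in>W. B e v * x v) = 0"
      using insert.IH[of W B] W by auto
    define S where "S = (\<Sum>v\<in>W. A e v * x v)"
    define y where "y = x(w := - S / A e w)"
    have sumy: "(\<Sum>v\<in>V. A e' v * y v) = (\<Sum>v\<in>W. A e' v * x v) - A e' w * S / A e w" for e'
    proof -
      have "(\<Sum>v\<in>W. A e' v * y v) = (\<Sum>v\<in>W. A e' v * x v)"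
        using W by (intro sum.cong) (auto simp: y_def)
      then show ?thesis using W by (simp add: y_def)
    qed
    have "(\<Sum>v\<in>V. A e' v * y v) = 0" if "e' \<in> E" for e'
    proof -
      have "0 = (\<Sum>v\<in>W. B e' v * x v)" using x that by auto
      also have "\<dots> = (\<Sum>v\<in>W. A e' v * x v) - (\<Sum>v\<in>W. A e' w / A e w * (A e v * x v))"
        by (simp add: B_def algebra_simps sum_subtractf)
      also have "\<dots> = (\<Sum>v\<in>V. A e' v * y v)"
        unfolding sumy S_def by (simp add: sum_distrib_left[symmetric] sum_divide_distrib[symmetric])
      finally show ?thesis by simp
    qed
    moreover have "(\<Sum>v\<in>V. A e v * y v) = 0" unfolding sumy using w by (simp add: S_def)
    moreover have "\<exists>v\<in>V. y v \<noteq> 0" using x W by (auto simp: y_def)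
    ultimately show ?thesis by (intro exI[of _ y]) auto
  qed
qed

section \<open>Polynomials in two variables and their total degree\<close>

definition eval2 :: "'a::comm_ring_1 poly poly \<Rightarrow> 'a \<Rightarrow> 'a \<Rightarrow> 'a" where
  "eval2 P x y = poly (poly P [:y:]) x"

lemma eval2_simps [simp]:
  "eval2 (P + Q) x y = eval2 P x y + eval2 Q x y"
  "eval2 (P - Q) x y = eval2 P x y - eval2 Q x y"
  "eval2 (- P) x y = - eval2 P x y"
  "eval2 (P * Q) x y = eval2 P x y * eval2 Q x y"
  "eval2 0 x y = 0" "eval2 1 x y = 1"
  "eval2 [:[:c:]:] x y = c"
  "eval2 (\<Sum>i\<in>I. f i) x y = (\<Sum>i\<in>I. eval2 (f i) x y)"
  by (simp_all add: eval2_def poly_sum)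

lemma eval2_dvd: "P dvd Q \<Longrightarrow> eval2 P x y = 0 \<Longrightarrow> eval2 Q x y = 0"
  by (auto elim!: dvdE)

lemma eval2_monom [simp]: "eval2 (monom (monom c i) j) x y = c * x ^ i * y ^ j"
  by (simp add: eval2_def poly_monom)

text \<open>Regarded as a polynomial over the domain \<open>real poly\<close>, \<open>P\<close>
  would have every constant \<open>[:y:]\<close> as a root, hence infinitely many roots.\<close>

lemma eval2_eq_0_imp:
  fixes P :: "real poly poly"
  assumes "\<And>x y. eval2 P x y = 0"
  shows "P = 0"
proof (rule ccontr)
  assume "P \<noteq> 0"
  then have "finite {c. poly P c = 0}" by (rule poly_roots_finite)
  moreover have "range (\<lambda>y. [:y:]) \<subseteq> {c. poly P c = 0}"
    using assms by (auto simp: eval2_def poly_all_0_iff_0[symmetric])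
  moreover have "infinite (range (\<lambda>y::real. [:y:]))"
    by (subst finite_image_iff) (auto intro!: injI simp: infinite_UNIV_char_0)
  ultimately show False using finite_subset by blast
qed

text \<open>The outer variable is y and the inner one x, so \<open>coeff (coeff P j) i\<close>
  belongs to x^i y^j. As a mere bound, it is compatible with sums and products without regard to
  cancellation.\<close>

definition total_degree_le :: "'a::zero poly poly \<Rightarrow> nat \<Rightarrow> bool" where
  "total_degree_le P d \<longleftrightarrow> (\<forall>i j. coeff (coeff P j) i \<noteq> 0 \<longrightarrow> i + j \<le> d)"

definition bidegrees :: "nat \<Rightarrow> (nat \<times> nat) set" where
  "bidegrees d = {(i, j). i + j \<le> d}"

lemma bidegrees_eq: "bidegrees d = (SIGMA i:{..d}. {..d - i})"
  by (auto simp: bidegrees_def)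

lemma finite_bidegrees [simp]: "finite (bidegrees d)"
  by (simp add: bidegrees_eq)

lemma card_bidegrees: "2 * card (bidegrees d) = (d + 1) * (d + 2)"
proof -
  have "card (bidegrees d) = (\<Sum>i\<le>d. Suc (d - i))"
    by (simp add: bidegrees_eq)
  also have "\<dots> = (\<Sum>i\<le>d. Suc i)"
    using sum.nat_diff_reindex[of Suc "Suc d"] by (simp add: lessThan_Suc_atMost)
  also have "2 * \<dots> = (d + 1) * (d + 2)" by (induction d) auto
  finally show ?thesis .
qed

lemma poly_poly_eq_sum:
  fixes P :: "'a::comm_ring_1 poly poly"
  assumes "total_degree_le P d"
  shows "P = (\<Sum>(i,j)\<in>bidegrees d. monom (monom (coeff (coeff P j) i) i) j)"
proof (intro poly_eqI)
  fix n m
  have "coeff (coeff (\<Sum>(i,j)\<in>bidegrees d. monom (monom (coeff (coeff P j) i) i) j) n) m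
     = (\<Sum>z\<in>bidegrees d. if z = (m,n) then coeff (coeff P n) m else 0)"
    by (simp only: coeff_sum case_prod_unfold, intro sum.cong) auto
  also have "\<dots> = (if (m,n) \<in> bidegrees d then coeff (coeff P n) m else 0)"
    by (simp add: sum.delta)
  also have "\<dots> = coeff (coeff P n) m" using assms by (auto simp: total_degree_le_def bidegrees_def)
  finally show "coeff (coeff P n) m = 
     coeff (coeff (\<Sum>(i,j)\<in>bidegrees d. monom (monom (coeff (coeff P j) i) i) j) n) m" by simp
qed

lemma eval2_eq_sum:
  assumes "total_degree_le P d"
  shows "eval2 P x y = (\<Sum>(i,j)\<in>bidegrees d. coeff (coeff P j) i * x ^ i * y ^ j)"
  by (subst poly_poly_eq_sum[OF assms]) (simp add: case_prod_unfold)

lemma coeff_coeff_mult: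
  "coeff (coeff (P * Q) j) i =
     (\<Sum>b\<le>j. \<Sum>a\<le>i. coeff (coeff P b) a * coeff (coeff Q (j - b)) (i - a))"
  by (simp add: coeff_mult coeff_sum)

lemma total_degree_le_mono: "total_degree_le P d \<Longrightarrow> d \<le> e \<Longrightarrow> total_degree_le P e"
  by (meson total_degree_le_def le_trans)

lemma total_degree_le_add:
  "total_degree_le P d \<Longrightarrow> total_degree_le Q d \<Longrightarrow> total_degree_le (P + Q) d"
  unfolding total_degree_le_def by (metis add.right_neutral coeff_add)

lemma total_degree_le_0 [simp]: "total_degree_le 0 d"
  by (simp add: total_degree_le_def)

lemma total_degree_le_sum:
  "(\<And>i. i \<in> I \<Longrightarrow> total_degree_le (f i) d) \<Longrightarrow> total_degree_le (\<Sum>i\<in>I. f i) d"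
  by (induction I rule: infinite_finite_induct) (auto intro: total_degree_le_add)

lemma total_degree_le_monom: "i + j \<le> d \<Longrightarrow> total_degree_le (monom (monom c i) j) d"
  by (auto simp: total_degree_le_def)

lemma total_degree_le_mult:
  assumes "total_degree_le P d" "total_degree_le Q e"
  shows "total_degree_le (P * Q) (d + e)"
  unfolding total_degree_le_def
proof (intro allI impI)
  fix i j assume "coeff (coeff (P * Q) j) i \<noteq> 0"
  then obtain b where b: "b \<le> j" "(\<Sum>a\<le>i. coeff (coeff P b) a * coeff (coeff Q (j - b)) (i - a)) \<noteq> 0"
    unfolding coeff_coeff_mult by (metis (no_types, lifting) sum.neutral atMost_iff)
  then obtain a where a: "a \<le> i" "coeff (coeff P b) a * coeff (coeff Q (j - b)) (i - a) \<noteq> 0"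
    by (metis (no_types, lifting) sum.neutral atMost_iff)
  then have "coeff (coeff P b) a \<noteq> 0" "coeff (coeff Q (j - b)) (i - a) \<noteq> 0" by auto
  then have "a + b \<le> d" "(i - a) + (j - b) \<le> e" using assms by (auto simp: total_degree_le_def)
  then show "i + j \<le> d + e" using a b by simp
qed

lemma ex_total_degree_le: "\<exists>d. total_degree_le P d"
proof (intro exI)
  show "total_degree_le P (Max ((\<lambda>j. degree (coeff P j)) ` {..degree P}) + degree P)"
    unfolding total_degree_le_def
  proof (intro allI impI)
    fix i j assume h: "coeff (coeff P j) i \<noteq> 0"
    then have j: "j \<le> degree P" by (metis coeff_0 le_degree)
    have "i \<le> degree (coeff P j)" using h le_degree by blast
    also have "\<dots> \<le> Max ((\<lambda>j. degree (coeff P j)) ` {..degree P})" using j by (intro Max_ge) auto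
    finally show "i + j \<le> Max ((\<lambda>j. degree (coeff P j)) ` {..degree P}) + degree P" using j by simp
  qed
qed

text \<open>The zero polynomial gets total degree 0, so total degree 0 does not yet mean a
  unit.\<close>

definition total_degree :: "'a::zero poly poly \<Rightarrow> nat" where
  "total_degree P = (LEAST d. total_degree_le P d)"

lemma total_degree_le_total_degree [simp]: "total_degree_le P (total_degree P)"
  unfolding total_degree_def using ex_total_degree_le by (rule LeastI_ex)

lemma total_degree_leI: "total_degree_le P d \<Longrightarrow> total_degree P \<le> d"
  unfolding total_degree_def by (rule Least_le)

lemma total_degree_attained:
  assumes "P \<noteq> 0"
  shows "\<exists>i j. i + j = total_degree P \<and> coeff (coeff P j) i \<noteq> 0"
proof (cases "total_degree P = 0")
  case True
  obtain i j where "coeff (coeff P j) i \<noteq> 0" using assms by (metis leading_coeff_0_iff)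
  then show ?thesis using total_degree_le_total_degree[of P] True unfolding total_degree_le_def by fastforce
next
  case False
  show ?thesis
  proof (rule ccontr)
    assume n: "\<not> ?thesis"
    have "total_degree_le P (total_degree P - 1)"
      unfolding total_degree_le_def
    proof (intro allI impI)
      fix i j assume h: "coeff (coeff P j) i \<noteq> 0"
      then have "i + j \<noteq> total_degree P" using n by auto
      moreover have "i + j \<le> total_degree P"
        using h total_degree_le_total_degree[of P] unfolding total_degree_le_def by blast
      ultimately show "i + j \<le> total_degree P - 1" by simp
    qed
    then have "total_degree P \<le> total_degree P - 1" by (rule total_degree_leI)
    then show False using False by simp
  qed
qed

lemma total_degree_mult_le:
  fixes P Q :: "'a::idom poly poly"
  assumes "P \<noteq> 0" "Q \<noteq> 0" "total_degree_le (P * Q) n"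
  shows "total_degree P + total_degree Q \<le> n"
proof -
  \<comment> \<open>Among the monomials of maximal total degree take the one with the largest exponent of the
    outer variable; in the product only the two chosen monomials contribute to theirs.\<close>
  have top: "\<exists>j. j \<le> total_degree R \<and> coeff (coeff R j) (total_degree R - j) \<noteq> 0 \<and>
      (\<forall>k. j < k \<and> k \<le> total_degree R \<longrightarrow> coeff (coeff R k) (total_degree R - k) = 0)"
    if "R \<noteq> 0" for R :: "'a poly poly"
  proof -
    let ?S = "{j. j \<le> total_degree R \<and> coeff (coeff R j) (total_degree R - j) \<noteq> 0}"
    have fin: "finite ?S" by simp
    obtain i j where "i + j = total_degree R" "coeff (coeff R j) i \<noteq> 0"
      using total_degree_attained[OF \<open>R \<noteq> 0\<close>] by auto
    then have ne: "?S \<noteq> {}" by (metis (mono_tags, lifting) add_diff_cancel_right' empty_iff le_add2 mem_Collect_eq)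
    have "Max ?S \<in> ?S" using Max_in fin ne by blast
    moreover have "coeff (coeff R k) (total_degree R - k) = 0"
      if "Max ?S < k" "k \<le> total_degree R" for k
      using Max_ge[OF fin, of k] that by fastforce
    ultimately show ?thesis by blast
  qed
  define d where "d = total_degree P"
  define e where "e = total_degree Q"
  obtain p where p: "p \<le> d" "coeff (coeff P p) (d - p) \<noteq> 0"
      "\<And>k. p < k \<Longrightarrow> k \<le> d \<Longrightarrow> coeff (coeff P k) (d - k) = 0"
    using top[OF assms(1)] unfolding d_def by blast
  obtain q where q: "q \<le> e" "coeff (coeff Q q) (e - q) \<noteq> 0"
      "\<And>k. q < k \<Longrightarrow> k \<le> e \<Longrightarrow> coeff (coeff Q k) (e - k) = 0"
    using top[OF assms(2)] unfolding e_def by blast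
  let ?i = "(d - p) + (e - q)" and ?j = "p + q"
  let ?t = "\<lambda>b a. coeff (coeff P b) a * coeff (coeff Q (?j - b)) (?i - a)"
  have z: "?t b a = 0" if "b \<le> ?j" "a \<le> ?i" "(b, a) \<noteq> (p, d - p)" for a b
  proof (rule ccontr)
    assume "?t b a \<noteq> 0"
    then have ab: "coeff (coeff P b) a \<noteq> 0" "coeff (coeff Q (?j - b)) (?i - a) \<noteq> 0" by auto
    then have "a + b \<le> d" "(?i - a) + (?j - b) \<le> e"
      using total_degree_le_total_degree unfolding total_degree_le_def d_def e_def by blast+
    then have s: "a = d - b" "b \<le> d" "?i - a = e - (?j - b)" "?j - b \<le> e"
      using that p q by auto
    then have "b \<le> p" using p(3)[of b] ab by force
    moreover have "?j - b \<le> q" using q(3)[of "?j - b"] ab s by force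
    ultimately have "b = p" using that by simp
    then show False using that s by simp
  qed
  have "coeff (coeff (P * Q) ?j) ?i = (\<Sum>b\<le>?j. \<Sum>a\<le>?i. ?t b a)"
    by (rule coeff_coeff_mult)
  also have "\<dots> = (\<Sum>(b,a)\<in>{..?j} \<times> {..?i}. ?t b a)" by (rule sum.cartesian_product)
  also have "\<dots> = (\<Sum>(b,a)\<in>{(p, d - p)}. ?t b a)"
  proof (intro sum.mono_neutral_right ballI)
    show "(case v of (b, a) \<Rightarrow> ?t b a) = 0" if "v \<in> {..?j} \<times> {..?i} - {(p, d - p)}" for v
      using z[of "fst v" "snd v"] that by (simp add: case_prod_unfold mem_Times_iff prod_eq_iff)
  qed auto
  also have "\<dots> \<noteq> 0" using p q by simp
  finally have "?i + ?j \<le> n" using assms(3) unfolding total_degree_le_def by blast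
  then show ?thesis using p q unfolding d_def e_def by simp
qed

lemma total_degree_eq_0_imp: "total_degree P = 0 \<Longrightarrow> \<exists>c. P = [:[:c:]:]"
proof -
  assume "total_degree P = 0"
  then have *: "coeff (coeff P j) i = 0" if "i + j \<noteq> 0" for i j
    using total_degree_le_total_degree[of P] that unfolding total_degree_le_def by force
  have "P = [:[:coeff (coeff P 0) 0:]:]"
    using * by (intro poly_eqI) (auto simp: coeff_pCons split: nat.split)
  then show ?thesis by blast
qed

text \<open>Lexicographic leading monomials, outer variable first, multiply over a domain. So a
  nonzero multiple of \<open>G\<close> has a nonzero coefficient at a multiple of the leading
  monomial of \<open>G\<close>.\<close>

lemma lex_leading_coeff_mult:
  fixes G H :: "'a::idom poly poly"
  assumes "G \<noteq> 0" "H \<noteq> 0"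
  shows "coeff (coeff (H * G) (degree H + degree G))
           (degree (lead_coeff H) + degree (lead_coeff G)) \<noteq> 0"
  using assms by (simp add: coeff_mult_degree_sum)

lemma separating_polynomial:
  fixes Z :: "(real \<times> real) set"
  assumes "finite Z" "p \<in> Z"
  shows "\<exists>D. total_degree_le D (card Z) \<and> eval2 D (fst p) (snd p) \<noteq> 0 \<and>
           (\<forall>q\<in>Z - {p}. eval2 D (fst q) (snd q) = 0)"
proof -
  have "\<exists>D. total_degree_le D (card W) \<and> eval2 D (fst p) (snd p) \<noteq> 0 \<and>
           (\<forall>q\<in>W. eval2 D (fst q) (snd q) = 0)" if "finite W" "p \<notin> W" for W :: "(real \<times> real) set"
    using that
  proof (induction W rule: finite_induct)
    case empty
    show ?case by (intro exI[of _ 1]) (auto simp: total_degree_le_def coeff_1 split: if_splits)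
  next
    case (insert q W)
    then obtain D where D: "total_degree_le D (card W)" "eval2 D (fst p) (snd p) \<noteq> 0"
         "\<forall>q\<in>W. eval2 D (fst q) (snd q) = 0" by auto
    define a where "a = fst p - fst q"
    define b where "b = snd p - snd q"
    \<comment> \<open>The inner product of (x, y) - q with p - q: it vanishes at q and is the
      squared distance from q at p.\<close>
    define L where "L = monom (monom a 1) 0 + monom (monom b 0) 1
       + monom (monom (- a * fst q - b * snd q) 0) 0"
    have L: "total_degree_le L 1"
      unfolding L_def by (intro total_degree_le_add total_degree_le_monom) auto
    have ev: "eval2 L x y = a * (x - fst q) + b * (y - snd q)" for x y
      by (simp add: L_def algebra_simps)
    have "a \<noteq> 0 \<or> b \<noteq> 0" using insert by (auto simp: a_def b_def prod_eq_iff)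
    then have "a * a + b * b \<noteq> 0" by (metis sum_squares_eq_zero_iff)
    then have "eval2 L (fst p) (snd p) \<noteq> 0" unfolding ev by (simp add: a_def b_def)
    moreover have "eval2 L (fst q) (snd q) = 0" by (simp add: ev)
    moreover have "total_degree_le (D * L) (card (insert q W))"
      using total_degree_le_mult[OF D(1) L] insert by simp
    ultimately show ?case using D by (intro exI[of _ "D * L"]) auto
  qed
  from this[of "Z - {p}"] obtain D where D: "total_degree_le D (card (Z - {p}))"
     "eval2 D (fst p) (snd p) \<noteq> 0" "\<forall>q\<in>Z - {p}. eval2 D (fst q) (snd q) = 0" using assms by auto
  moreover have "total_degree_le D (card Z)"
    using D(1) by (rule total_degree_le_mono) (metis assms card_Diff1_le)
  ultimately show ?thesis by blast
qed

text \<open>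
  Let \<open>M\<close> be the lexicographic leading monomial of \<open>G\<close>. If there were too many common zeros, a
  count of unknowns and equations would give a nontrivial relation
  \<open>A * F + A' * G + (\<Sum>p. x p * D p) = 0\<close> in some large degree, where \<open>D p\<close> separates \<open>p\<close> from the
  other zeros and the coefficients of \<open>A\<close> at the multiples of \<open>M\<close> vanish. Evaluation at the zeros
  kills the \<open>x p\<close>, coprimality then gives \<open>A = H * G\<close>, and the leading coefficient of \<open>A\<close> sits at a
  multiple of \<open>M\<close>, so that \<open>A = 0\<close>.
\<close>
lemma bezout_bound:
  fixes F G :: "real poly poly"
  assumes cop: "coprime F G" and nz: "F \<noteq> 0" "G \<noteq> 0"
    and Z: "finite Z" "\<And>x y. (x, y) \<in> Z \<Longrightarrow> eval2 F x y = 0 \<and> eval2 G x y = 0"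
  shows "card Z \<le> total_degree F * total_degree G"
proof (rule ccontr)
  assume big: "\<not> ?thesis"
  define e where "e = total_degree F"
  define f where "f = total_degree G"
  define d where "d = e + f + card Z"
  define \<beta> where "\<beta> = degree G"
  define \<alpha> where "\<alpha> = degree (lead_coeff G)"
  have "\<exists>D. \<forall>p\<in>Z. total_degree_le (D p) (card Z) \<and> eval2 (D p) (fst p) (snd p) \<noteq> 0 \<and>
           (\<forall>q\<in>Z - {p}. eval2 (D p) (fst q) (snd q) = 0)"
    using separating_polynomial[OF Z(1)] by (intro bchoice) auto
  then obtain D where D: "\<And>p. p \<in> Z \<Longrightarrow> total_degree_le (D p) (card Z)"
      "\<And>p. p \<in> Z \<Longrightarrow> eval2 (D p) (fst p) (snd p) \<noteq> 0"
      "\<And>p q. p \<in> Z \<Longrightarrow> q \<in> Z \<Longrightarrow> q \<noteq> p \<Longrightarrow> eval2 (D p) (fst q) (snd q) = 0"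
    by blast
  define V :: "((nat \<times> nat) + (nat \<times> nat) + (real \<times> real)) set"
    where "V = bidegrees (d - e) <+> (bidegrees (d - f) <+> Z)"
  define E :: "((nat \<times> nat) + (nat \<times> nat)) set"
    where "E = bidegrees d <+> bidegrees (d - e - f)"
  define B :: "(nat \<times> nat) + (nat \<times> nat) + (real \<times> real) \<Rightarrow> real poly poly"
    where "B = (\<lambda>v. case v of Inl (i,j) \<Rightarrow> monom (monom 1 i) j * F
                     | Inr (Inl (i,j)) \<Rightarrow> monom (monom 1 i) j * G
                     | Inr (Inr p) \<Rightarrow> D p)"
  define M where "M = (\<lambda>eq v. case eq of Inl (i,j) \<Rightarrow> coeff (coeff (B v) j) i
       | Inr (i,j) \<Rightarrow> (if v = Inl (i + \<alpha>, j + \<beta>) then 1 else 0 :: real))"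
  have finV: "finite V" and finE: "finite E" using Z(1) by (auto simp: V_def E_def)
  \<comment> \<open>There are (k + 1) (k + 2) / 2 monomials of degree at most k. In the balance the
    quadratic terms leave \<open>card V - card E = card Z - e * f\<close>, which is where the
    product of the degrees comes from.\<close>
  have cards: "card E < card V"
  proof -
    have cV: "card V = card (bidegrees (d - e)) + (card (bidegrees (d - f)) + card Z)"
      using Z(1) by (simp add: V_def card_Plus)
    have cE: "card E = card (bidegrees d) + card (bidegrees (d - e - f))"
      by (simp add: E_def card_Plus)
    define z where "z = card Z"
    have zb: "e * f < z" using big by (simp add: z_def e_def f_def)
    have s: "d = e + f + z" "d - e = f + z" "d - f = e + z" "d - e - f = z"
      by (auto simp: d_def z_def)
    have "2 * card E < 2 * card V"
      unfolding cV cE distrib_left card_bidegrees s(2-4) z_def[symmetric]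
      using zb by (simp add: s(1) algebra_simps)
    then show ?thesis by simp
  qed
  obtain x where x: "\<exists>v\<in>V. x v \<noteq> 0" "\<And>eq. eq \<in> E \<Longrightarrow> (\<Sum>v\<in>V. M eq v * x v) = 0"
    using homogeneous_system_nontrivial_solution[OF finE finV cards, of M] by blast
  define A where "A = (\<Sum>(i,j)\<in>bidegrees (d - e). monom (monom (x (Inl (i,j))) i) j)"
  define A' where "A' = (\<Sum>(i,j)\<in>bidegrees (d - f). monom (monom (x (Inr (Inl (i,j)))) i) j)"
  define C where "C = (\<Sum>p\<in>Z. [:[:x (Inr (Inr p)):]:] * D p)"
  have cf: "coeff (coeff (\<Sum>(i,j)\<in>bidegrees k. monom (monom (y (i,j)) i) j) n) m = 
      (if m + n \<le> k then y (m,n) else 0)" for k m n and y :: "_ \<Rightarrow> real"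
  proof -
    have "coeff (coeff (\<Sum>(i,j)\<in>bidegrees k. monom (monom (y (i,j)) i) j) n) m
     = (\<Sum>z\<in>bidegrees k. if z = (m,n) then y (m,n) else 0)"
    by (simp only: coeff_sum case_prod_unfold, intro sum.cong) auto
    also have "\<dots> = (if (m,n) \<in> bidegrees k then y (m,n) else 0)"
      by (simp add: sum.delta)
    finally show ?thesis by (simp add: bidegrees_def)
  qed
  have tA: "total_degree_le A (d - e)" and tA': "total_degree_le A' (d - f)"
    unfolding A_def A'_def by (auto intro!: total_degree_le_sum total_degree_le_monom simp: bidegrees_def)
  have tC: "total_degree_le C (card Z)"
    unfolding C_def
  proof (intro total_degree_le_sum)
    fix p assume "p \<in> Z"
    have "total_degree_le [:[:x (Inr (Inr p)):]:] 0"
      by (auto simp: total_degree_le_def coeff_pCons split: nat.splits)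
    from total_degree_le_mult[OF this D(1)[OF \<open>p \<in> Z\<close>]]
    show "total_degree_le ([:[:x (Inr (Inr p)):]:] * D p) (card Z)" by simp
  qed
  have mon: "monom (monom c i) j = [:[:c:]:] * monom (monom 1 i) j" for c :: real and i j
    by (simp add: smult_monom)
  have relsum: "A * F + A' * G + C = (\<Sum>v\<in>V. [:[:x v:]:] * B v)"
  proof -
    have "(\<Sum>v\<in>V. [:[:x v:]:] * B v) = 
       (\<Sum>v\<in>bidegrees (d - e). [:[:x (Inl v):]:] * B (Inl v)) +
       ((\<Sum>v\<in>bidegrees (d - f). [:[:x (Inr (Inl v)):]:] * B (Inr (Inl v))) + 
        (\<Sum>v\<in>Z. [:[:x (Inr (Inr v)):]:] * B (Inr (Inr v))))"
      unfolding V_def using Z(1) by (subst sum.Plus; simp add: sum.Plus)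
    also have "(\<Sum>v\<in>bidegrees (d - e). [:[:x (Inl v):]:] * B (Inl v)) = A * F"
      unfolding A_def sum_distrib_right
      by (intro sum.cong refl) (auto simp: B_def mon[of "x _"])
    also have "(\<Sum>v\<in>bidegrees (d - f). [:[:x (Inr (Inl v)):]:] * B (Inr (Inl v))) = A' * G"
      unfolding A'_def sum_distrib_right
      by (intro sum.cong refl) (auto simp: B_def mon[of "x _"])
    also have "(\<Sum>v\<in>Z. [:[:x (Inr (Inr v)):]:] * B (Inr (Inr v))) = C"
      unfolding C_def by (simp add: B_def)
    finally show ?thesis by simp
  qed
  have td: "total_degree_le (A * F + A' * G + C) d"
  proof (intro total_degree_le_add)
    show "total_degree_le (A * F) d"
      using total_degree_le_mult[OF tA total_degree_le_total_degree[of F]] by (simp add: d_def e_def add_ac)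
    show "total_degree_le (A' * G) d"
      using total_degree_le_mult[OF tA' total_degree_le_total_degree[of G]] by (simp add: d_def f_def add_ac)
    show "total_degree_le C d" using tC by (rule total_degree_le_mono) (simp add: d_def)
  qed
  have rel: "A * F + A' * G + C = 0"
  proof (intro poly_eqI)
    fix j i
    show "coeff (coeff (A * F + A' * G + C) j) i = coeff (coeff 0 j) i"
    proof (cases "i + j \<le> d")
      case True
      then have "Inl (i,j) \<in> E" by (auto simp: E_def bidegrees_def)
      from x(2)[OF this] have "(\<Sum>v\<in>V. coeff (coeff (B v) j) i * x v) = 0" by (simp add: M_def)
      then show ?thesis unfolding relsum by (simp add: coeff_sum mult.commute)
    next
      case False
      then show ?thesis using td unfolding total_degree_le_def by force
    qed
  qed
  have c0: "x (Inr (Inr p)) = 0" if "p \<in> Z" for p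
  proof -
    have "0 = eval2 (A * F + A' * G + C) (fst p) (snd p)" by (simp add: rel)
    also have "\<dots> = eval2 C (fst p) (snd p)" using Z(2)[of "fst p" "snd p"] that by simp
    also have "\<dots> = (\<Sum>q\<in>Z. x (Inr (Inr q)) * eval2 (D q) (fst p) (snd p))"
      unfolding C_def by (simp only: eval2_simps)
    also have "\<dots> = (\<Sum>q\<in>{p}. x (Inr (Inr q)) * eval2 (D q) (fst p) (snd p))"
      proof (intro sum.mono_neutral_right ballI)
      show "x (Inr (Inr q)) * eval2 (D q) (fst p) (snd p) = 0" if "q \<in> Z - {p}" for q
        using D(3)[of q p] that \<open>p \<in> Z\<close> by auto
    qed (use that Z(1) in auto)
    finally show ?thesis using D(2)[OF that] by simp
  qed
  then have "C = 0" unfolding C_def by (intro sum.neutral) auto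
  then have AF: "A * F = - A' * G" using rel by (simp add: add_eq_0_iff)
  then have "G dvd A * F" by simp
  then have "G dvd A" using cop by (simp add: coprime_dvd_mult_left_iff coprime_commute)
  then obtain H where H: "A = H * G" by (metis dvd_def mult.commute)
  \<comment> \<open>The equations control only the multiples of the leading monomial of
    \<open>G\<close> by monomials of degree at most \<open>d - e - f\<close>. This suffices even if
    that monomial has total degree below \<open>f\<close>: total degrees add, so \<open>H\<close>
    has degree at most \<open>d - e - f\<close>.\<close>
  have "H = 0"
  proof (rule ccontr)
    assume "H \<noteq> 0"
    let ?j = "degree H" and ?i = "degree (lead_coeff H)"
    have "total_degree H + f \<le> d - e"
      unfolding f_def using \<open>H \<noteq> 0\<close> nz tA H by (intro total_degree_mult_le) auto
    moreover have "?i + ?j \<le> total_degree H"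
      using \<open>H \<noteq> 0\<close> total_degree_le_total_degree[of H] unfolding total_degree_le_def by auto
    ultimately have ij: "?i + ?j \<le> d - e - f" by simp
    have ne: "coeff (coeff A (?j + \<beta>)) (?i + \<alpha>) \<noteq> 0"
      unfolding H \<alpha>_def \<beta>_def using \<open>H \<noteq> 0\<close> nz by (intro lex_leading_coeff_mult)
    then have "?i + \<alpha> + (?j + \<beta>) \<le> d - e" using tA unfolding total_degree_le_def by blast
    then have mem: "Inl (?i + \<alpha>, ?j + \<beta>) \<in> V" by (auto simp: V_def bidegrees_def)
    have "Inr (?i, ?j) \<in> E" using ij by (auto simp: E_def bidegrees_def)
    from x(2)[OF this] have "(\<Sum>v\<in>V. (if v = Inl (?i + \<alpha>, ?j + \<beta>) then 1 else 0) * x v) = 0"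
      by (simp add: M_def)
    then have "x (Inl (?i + \<alpha>, ?j + \<beta>)) = 0" using mem finV
      by (simp add: if_distrib[of "\<lambda>t. t * _"] sum.delta cong: if_cong)
    then show False using ne unfolding A_def cf[of "\<lambda>v. x (Inl v)"] by (simp split: if_splits)
  qed
  then have "A = 0" by (simp add: H)
  then have "A' = 0" using AF nz by simp
  have "x v = 0" if "v \<in> V" for v
    using that unfolding V_def
  proof (elim PlusE)
    fix ij assume "v = Inl ij" "ij \<in> bidegrees (d - e)"
    then show ?thesis using cf[of "\<lambda>v. x (Inl v)" "d - e" "snd ij" "fst ij"] \<open>A = 0\<close>
      unfolding A_def[symmetric] by (auto simp: bidegrees_def)
  next
    fix w ij assume "v = Inr w" "w = Inl ij" "ij \<in> bidegrees (d - f)"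
    then show ?thesis using cf[of "\<lambda>v. x (Inr (Inl v))" "d - f" "snd ij" "fst ij"] \<open>A' = 0\<close>
      unfolding A'_def[symmetric] by (auto simp: bidegrees_def)
  next
    fix w p assume "v = Inr w" "w = Inr p" "p \<in> Z"
    then show ?thesis using c0 by simp
  qed
  then show False using x(1) by blast
qed

section \<open>Homogeneous and harmonic polynomials\<close>

text \<open>Homogeneous polynomials as generated functions, so that most facts follow by rule
  induction without handling coefficients. The zero function belongs to every degree.\<close>

inductive homog_poly :: "nat \<Rightarrow> (real ^ 3 \<Rightarrow> real) \<Rightarrow> bool" where
  const: "homog_poly 0 (\<lambda>x. c)"
| add: "homog_poly d p \<Longrightarrow> homog_poly d q \<Longrightarrow> homog_poly d (\<lambda>x. p x + q x)"
| coord: "homog_poly d p \<Longrightarrow> homog_poly (Suc d) (\<lambda>x. x $ i * p x)"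

lemma homog_poly_scale: "homog_poly d p \<Longrightarrow> homog_poly d (\<lambda>x. c * p x)"
proof (induction rule: homog_poly.induct)
  case (const c')
  show ?case by (rule homog_poly.const)
next
  case (add d p q)
  then show ?case using homog_poly.add by (simp add: distrib_left)
next
  case (coord d p i)
  then show ?case using homog_poly.coord[of d "\<lambda>x. c * p x" i] by (simp add: mult.left_commute)
qed

lemma homog_poly_zero [simp]: "homog_poly d (\<lambda>x. 0)"
proof (induction d)
  case 0
  show ?case by (rule homog_poly.const)
next
  case (Suc d)
  then show ?case using homog_poly.coord by fastforce
qed

lemma homog_poly_sum: "(\<And>i. i \<in> I \<Longrightarrow> homog_poly d (f i)) \<Longrightarrow> homog_poly d (\<lambda>x. \<Sum>i\<in>I. f i x)"
  by (induction I rule: infinite_finite_induct) (auto intro: homog_poly.add)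

lemma homog_poly_diff: "homog_poly d p \<Longrightarrow> homog_poly d q \<Longrightarrow> homog_poly d (\<lambda>x. p x - q x)"
  using homog_poly.add[of d p "\<lambda>x. (-1) * q x"] homog_poly_scale[of d q "-1"] by simp

lemma homog_poly_mult: "homog_poly d p \<Longrightarrow> homog_poly e q \<Longrightarrow> homog_poly (d + e) (\<lambda>x. p x * q x)"
proof (induction rule: homog_poly.induct)
  case (const c)
  then show ?case by (simp add: homog_poly_scale)
next
  case (add d p q)
  then show ?case by (simp add: distrib_right homog_poly.add)
next
  case (coord d p i)
  then show ?case using homog_poly.coord[of "d + e" "\<lambda>x. p x * q x" i] by (simp add: mult.assoc)
qed

lemma homog_poly_power: "homog_poly d p \<Longrightarrow> homog_poly (d * k) (\<lambda>x. p x ^ k)"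
  by (induction k) (auto intro: homog_poly.const homog_poly_mult)

lemma homog_poly_component: "homog_poly 1 (\<lambda>x. x $ i)"
  using homog_poly.coord[OF homog_poly.const[of 1], of i] by simp

lemma homog_poly_inner: "homog_poly 1 (\<lambda>x. x \<bullet> a)"
proof -
  have "homog_poly 1 (\<lambda>x. \<Sum>i\<in>UNIV. a $ i * x $ i)"
    by (intro homog_poly_sum homog_poly_scale homog_poly_component)
  then show ?thesis by (simp add: inner_vec_def mult.commute)
qed

definition pderiv3 :: "3 \<Rightarrow> (real ^ 3 \<Rightarrow> real) \<Rightarrow> real ^ 3 \<Rightarrow> real" where
  "pderiv3 i p x = frechet_derivative p (at x) (axis i 1)"

lemma homog_poly_differentiable: "homog_poly d p \<Longrightarrow> p differentiable at x"
  by (induction rule: homog_poly.induct) (auto intro!: differentiable_mult bounded_linear_imp_differentiable[OF bounded_linear_vec_nth])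

lemma homog_poly_continuous_on: "homog_poly d p \<Longrightarrow> continuous_on S p"
  by (induction rule: homog_poly.induct) (auto intro!: continuous_intros)

lemma homog_poly_frechet:
  assumes "homog_poly d p"
  shows "frechet_derivative p (at x) h = (\<Sum>i\<in>UNIV. h $ i * pderiv3 i p x)"
proof -
  have "linear (frechet_derivative p (at x))"
    using homog_poly_differentiable[OF assms] by (rule linear_frechet_derivative)
  then interpret linear "frechet_derivative p (at x)" .
  have "h = (\<Sum>i\<in>UNIV. h $ i *\<^sub>R axis i 1)" by (simp add: basis_expansion scalar_mult_eq_scaleR[symmetric])
  then have "frechet_derivative p (at x) h = frechet_derivative p (at x) (\<Sum>i\<in>UNIV. h $ i *\<^sub>R axis i 1)"
    by simp
  then show ?thesis by (simp add: sum scale pderiv3_def)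
qed

lemma pderiv3_eqI: "(p has_derivative D) (at x) \<Longrightarrow> pderiv3 i p x = D (axis i 1)"
  by (simp add: pderiv3_def frechet_derivative_at[symmetric])

lemma homog_poly_has_derivative:
  "homog_poly d p \<Longrightarrow> (p has_derivative (\<lambda>h. \<Sum>i\<in>UNIV. h $ i * pderiv3 i p x)) (at x)"
  using homog_poly_differentiable[of d p x] homog_poly_frechet[of d p x]
  by (metis (no_types, lifting) ext frechet_derivative_works)

lemma sum_axis_mult [simp]: "(\<Sum>j\<in>UNIV. axis i 1 $ j * f j) = (f i :: real)" for i :: 3
  by (simp add: axis_def if_distrib[of "\<lambda>t. t * _"] cong: if_cong)

lemma pderiv3_const [simp]: "pderiv3 i (\<lambda>x. c) = (\<lambda>x. 0)"
  by (simp add: pderiv3_def fun_eq_iff)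

lemma pderiv3_add:
  assumes "homog_poly d p" "homog_poly e q"
  shows "pderiv3 i (\<lambda>x. p x + q x) = (\<lambda>x. pderiv3 i p x + pderiv3 i q x)"
  by (rule ext, subst pderiv3_eqI[OF has_derivative_add[OF homog_poly_has_derivative[OF assms(1)]
         homog_poly_has_derivative[OF assms(2)]]]) simp

lemma pderiv3_mult:
  assumes "homog_poly d p" "homog_poly e q"
  shows "pderiv3 i (\<lambda>x. p x * q x) = (\<lambda>x. pderiv3 i p x * q x + p x * pderiv3 i q x)"
  by (rule ext, subst pderiv3_eqI[OF has_derivative_mult[OF homog_poly_has_derivative[OF assms(1)]
         homog_poly_has_derivative[OF assms(2)]]]) simp

lemma pderiv3_scale:
  assumes "homog_poly d p"
  shows "pderiv3 i (\<lambda>x. c * p x) = (\<lambda>x. c * pderiv3 i p x)"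
  using pderiv3_mult[OF homog_poly.const[of c] assms] by simp

lemma pderiv3_component: "pderiv3 i (\<lambda>x. x $ j) = (\<lambda>x. if i = j then 1 else 0)"
proof
  fix x :: "real ^ 3"
  have "((\<lambda>x. x $ j) has_derivative (\<lambda>h. h $ j)) (at x)"
    by (rule bounded_linear_imp_has_derivative) (rule bounded_linear_vec_nth)
  from pderiv3_eqI[OF this] show "pderiv3 i (\<lambda>x. x $ j) x = (if i = j then 1 else 0)"
    by (auto simp: axis_def)
qed

lemma pderiv3_coord:
  assumes "homog_poly d p"
  shows "pderiv3 i (\<lambda>x. x $ j * p x) = (\<lambda>x. (if i = j then p x else 0) + x $ j * pderiv3 i p x)"
  by (subst pderiv3_mult[OF homog_poly_component assms]) (auto simp: pderiv3_component)

lemma pderiv3_diff: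
  assumes "homog_poly d p" "homog_poly e q"
  shows "pderiv3 i (\<lambda>x. p x - q x) = (\<lambda>x. pderiv3 i p x - pderiv3 i q x)"
  by (rule ext, subst pderiv3_eqI[OF has_derivative_diff[OF homog_poly_has_derivative[OF assms(1)]
         homog_poly_has_derivative[OF assms(2)]]]) (simp add: right_diff_distrib sum_subtractf)

lemma pderiv3_degree_0: "homog_poly 0 p \<Longrightarrow> pderiv3 i p = (\<lambda>x. 0)"
proof (induction "0::nat" p rule: homog_poly.induct)
  case (add p q)
  then show ?case by (simp add: pderiv3_add[OF add.hyps(1,3)])
qed simp_all

text \<open>In degree 0 the truncated \<open>d - 1\<close> is 0 again, which is correct because the
  derivative is then the zero function.\<close>

lemma homog_poly_pderiv3: "homog_poly d p \<Longrightarrow> homog_poly (d - 1) (pderiv3 i p)"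
proof (induction rule: homog_poly.induct)
  case (const c)
  then show ?case by simp
next
  case (add d p q)
  then show ?case by (simp add: pderiv3_add[OF add.hyps] homog_poly.add)
next
  case (coord d p j)
  have "homog_poly d (\<lambda>x. x $ j * pderiv3 i p x)"
  proof (cases d)
    case 0
    then have "pderiv3 i p = (\<lambda>x. 0)" using coord.hyps pderiv3_degree_0 by simp
    then show ?thesis by simp
  next
    case (Suc k)
    then show ?thesis using homog_poly.coord[OF coord.IH, of j] by simp
  qed
  then have "homog_poly d (\<lambda>x. (if i = j then p x else 0) + x $ j * pderiv3 i p x)"
    using coord.hyps by (cases "i = j") (auto intro: homog_poly.add)
  then show ?case by (simp add: pderiv3_coord[OF coord.hyps])
qed

lemma homog_poly_coord_pderiv3:
  "homog_poly d p \<Longrightarrow> homog_poly d (\<lambda>x. x $ j * pderiv3 i p x)"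
  using homog_poly.coord[OF homog_poly_pderiv3[of d p i], of j] pderiv3_degree_0[of p i]
  by (cases d) auto

lemma euler_homog_poly:
  "homog_poly d p \<Longrightarrow> (\<Sum>i\<in>UNIV. x $ i * pderiv3 i p x) = real d * p x"
proof (induction arbitrary: x rule: homog_poly.induct)
  case (const c)
  then show ?case by simp
next
  case (add d p q)
  then show ?case by (simp add: pderiv3_add[OF add.hyps] distrib_left sum.distrib)
next
  case (coord d p j)
  have "(\<Sum>i\<in>UNIV. x $ i * pderiv3 i (\<lambda>x. x $ j * p x) x)
     = (\<Sum>i\<in>UNIV. (if i = j then x $ i * p x else 0)) + x $ j * (\<Sum>i\<in>UNIV. x $ i * pderiv3 i p x)"
    unfolding pderiv3_coord[OF coord.hyps] sum_distrib_left sum.distrib[symmetric]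
    by (intro sum.cong) (auto simp: algebra_simps)
  also have "\<dots> = real (Suc d) * (x $ j * p x)"
    by (simp add: coord.IH algebra_simps)
  finally show ?case .
qed

lemma pderiv3_commute: "homog_poly d p \<Longrightarrow> pderiv3 i (pderiv3 j p) = pderiv3 j (pderiv3 i p)"
proof (induction rule: homog_poly.induct)
  case (const c)
  then show ?case by simp
next
  case (add d p q)
  then show ?case
    by (simp add: pderiv3_add[OF add.hyps] pderiv3_add[OF homog_poly_pderiv3 homog_poly_pderiv3, OF add.hyps])
next
  case (coord d p k)
  note D = homog_poly_pderiv3[OF coord.hyps]
  have "pderiv3 i (pderiv3 j (\<lambda>x. x $ k * p x)) =
     (\<lambda>x. (if j = k then pderiv3 i p x else 0) + ((if i = k then pderiv3 j p x else 0)
        + x $ k * pderiv3 i (pderiv3 j p) x))" for i j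
    unfolding pderiv3_coord[OF coord.hyps]
  proof (cases "j = k")
    case True
    then show "pderiv3 i (\<lambda>x. (if j = k then p x else 0) + x $ k * pderiv3 j p x) = 
     (\<lambda>x. (if j = k then pderiv3 i p x else 0) + ((if i = k then pderiv3 j p x else 0)
        + x $ k * pderiv3 i (pderiv3 j p) x))"
      by (auto simp: pderiv3_add[OF coord.hyps homog_poly.coord[OF D]] pderiv3_coord[OF D])
  next
    case False
    then show "pderiv3 i (\<lambda>x. (if j = k then p x else 0) + x $ k * pderiv3 j p x) = 
     (\<lambda>x. (if j = k then pderiv3 i p x else 0) + ((if i = k then pderiv3 j p x else 0)
        + x $ k * pderiv3 i (pderiv3 j p) x))"
      by (simp add: pderiv3_coord[OF D])
  qed
  then show ?case by (simp add: coord.IH fun_eq_iff)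
qed

lemma pderiv3_pderiv3_coord:
  assumes "homog_poly d p"
  shows "pderiv3 i (pderiv3 i (\<lambda>x. x $ a * p x)) =
    (\<lambda>x. (if i = a then 2 * pderiv3 a p x else 0) + x $ a * pderiv3 i (pderiv3 i p) x)"
proof -
  note D = homog_poly_pderiv3[OF assms]
  note C = homog_poly.coord[OF D]
  show ?thesis
    unfolding pderiv3_coord[OF assms]
    by (cases "i = a") (auto simp: pderiv3_add[OF assms C] pderiv3_coord[OF D] fun_eq_iff)
qed

definition harmonic_poly :: "nat \<Rightarrow> (real ^ 3 \<Rightarrow> real) \<Rightarrow> bool" where
  "harmonic_poly d p \<longleftrightarrow> homog_poly d p \<and> (\<forall>x. (\<Sum>i\<in>UNIV. pderiv3 i (pderiv3 i p) x) = 0)"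

lemma harmonic_polyD: "harmonic_poly d p \<Longrightarrow> homog_poly d p"
  by (simp add: harmonic_poly_def)

lemma harmonic_poly_add:
  assumes "harmonic_poly d p" "harmonic_poly d q"
  shows "harmonic_poly d (\<lambda>x. p x + q x)"
  using assms unfolding harmonic_poly_def
  by (auto simp: pderiv3_add[of d p d q] pderiv3_add[OF homog_poly_pderiv3[of d p] homog_poly_pderiv3[of d q]]
      sum.distrib intro: homog_poly.add)

lemma harmonic_poly_scale:
  assumes "harmonic_poly d p"
  shows "harmonic_poly d (\<lambda>x. c * p x)"
  using assms unfolding harmonic_poly_def
  by (auto simp: pderiv3_scale[of d p] pderiv3_scale[OF homog_poly_pderiv3[of d p]]
      sum_distrib_left[symmetric] intro: homog_poly_scale)

lemma harmonic_poly_zero: "harmonic_poly d (\<lambda>x. 0)"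
  by (simp add: harmonic_poly_def)

lemma harmonic_poly_sum:
  "(\<And>i. i \<in> I \<Longrightarrow> harmonic_poly d (f i)) \<Longrightarrow> harmonic_poly d (\<lambda>x. \<Sum>i\<in>I. f i x)"
  by (induction I rule: infinite_finite_induct) (auto intro: harmonic_poly_add harmonic_poly_zero)

lemma harmonic_poly_pderiv3:
  assumes "harmonic_poly d p"
  shows "harmonic_poly (d - 1) (pderiv3 j p)"
proof -
  have h: "homog_poly d p" and z: "(\<lambda>x. \<Sum>i\<in>UNIV. pderiv3 i (pderiv3 i p) x) = (\<lambda>x. 0)"
    using assms by (auto simp: harmonic_poly_def)
  note D2 = homog_poly_pderiv3[OF homog_poly_pderiv3[OF h]]
  have "pderiv3 i (pderiv3 i (pderiv3 j p)) = pderiv3 j (pderiv3 i (pderiv3 i p))" for i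
    using pderiv3_commute[OF h] pderiv3_commute[OF homog_poly_pderiv3[OF h]] by metis
  then have "(\<Sum>i\<in>UNIV. pderiv3 i (pderiv3 i (pderiv3 j p)) x)
      = pderiv3 j (\<lambda>x. \<Sum>i\<in>UNIV. pderiv3 i (pderiv3 i p) x) x" for x
    by (simp add: sum_3 pderiv3_add[OF homog_poly.add[OF D2 D2] D2] pderiv3_add[OF D2 D2])
  then show ?thesis unfolding z using homog_poly_pderiv3[OF h] by (simp add: harmonic_poly_def)
qed

text \<open>The generators of rotations commute with the Laplacian: differentiating
  \<open>x $ a * pderiv3 b p x\<close> twice leaves the extra term
  \<open>2 * pderiv3 a (pderiv3 b p)\<close>, which is symmetric in \<open>a\<close> and
  \<open>b\<close> and cancels in the difference.\<close>

lemma harmonic_poly_rotation: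
  assumes "harmonic_poly d p"
  shows "harmonic_poly d (\<lambda>x. x $ a * pderiv3 b p x - x $ b * pderiv3 a p x)"
proof -
  have h: "homog_poly d p" and z: "\<And>j. (\<Sum>i\<in>UNIV. pderiv3 i (pderiv3 i (pderiv3 j p)) x) = 0" for x
    using assms harmonic_poly_pderiv3[OF assms] by (auto simp: harmonic_poly_def)
  note D = homog_poly_pderiv3[OF h]
  note C = homog_poly_coord_pderiv3[OF h]
  have "pderiv3 i (pderiv3 i (\<lambda>x. x $ a * pderiv3 b p x - x $ b * pderiv3 a p x)) =
      (\<lambda>x. pderiv3 i (pderiv3 i (\<lambda>x. x $ a * pderiv3 b p x)) x - pderiv3 i (pderiv3 i (\<lambda>x. x $ b * pderiv3 a p x)) x)" for i
    unfolding pderiv3_diff[OF C C]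
    by (rule pderiv3_diff[OF homog_poly_pderiv3[OF C] homog_poly_pderiv3[OF C]])
  then have "(\<Sum>i\<in>UNIV. pderiv3 i (pderiv3 i (\<lambda>x. x $ a * pderiv3 b p x - x $ b * pderiv3 a p x)) x) = 0" for x
    using pderiv3_commute[OF h, of a b]
    by (simp add: pderiv3_pderiv3_coord[OF D] sum_subtractf sum.distrib sum_distrib_left[symmetric] z)
  then show ?thesis unfolding harmonic_poly_def by (auto intro: homog_poly_diff C)
qed

section \<open>Gaussian orthogonality\<close>

lemma basis_3: "(Basis :: (real ^ 3) set) = (\<lambda>i. axis i 1) ` UNIV"
  by (auto simp: Basis_vec_def)

text \<open>Fubini for a product of functions of one coordinate each. The underlying product measure
  is indexed by basis vectors rather than by coordinates, and \<open>ix\<close> translates between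
  the two.\<close>

lemma has_bochner_integral_lborel_prod:
  fixes h :: "3 \<Rightarrow> real \<Rightarrow> real"
  assumes "\<And>i. has_bochner_integral lborel (h i) (I i)"
  shows "has_bochner_integral lborel (\<lambda>x :: real ^ 3. \<Prod>i\<in>UNIV. h i (x $ i)) (\<Prod>i\<in>UNIV. I i)"
proof -
  interpret P: product_sigma_finite "\<lambda>b :: real ^ 3. lborel :: real measure"
    by standard
  define ix where "ix = inv_into UNIV (\<lambda>i :: 3. axis i (1 :: real))"
  have inj: "inj (\<lambda>i :: 3. axis i (1 :: real))" by (auto intro!: injI simp: axis_eq_axis)
  have ix: "ix (axis i 1) = i" for i unfolding ix_def using inj by (rule inv_f_f)
  define g where "g = (\<lambda>b :: real ^ 3. h (ix b))"
  have int: "integrable lborel (g b)" and val: "integral\<^sup>L lborel (g b) = I (ix b)" for b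
    using assms by (auto simp: g_def has_bochner_integral_iff)
  have meas: "(\<lambda>x. h i (x $ i)) \<in> borel_measurable borel" for i
  proof -
    have "h i \<in> borel_measurable borel" using assms[of i] by (auto simp: has_bochner_integral_iff)
    then show ?thesis by measurable
  qed
  have eq: "(\<Prod>i\<in>UNIV. h i ((\<Sum>b\<in>Basis. f b *\<^sub>R b) $ i)) = (\<Prod>b\<in>Basis. g b (f b))" for f :: "real ^ 3 \<Rightarrow> real"
  proof -
    have "(\<Sum>b\<in>Basis. f b *\<^sub>R b) $ i = f (axis i 1)" for i
    proof -
      have "(\<Sum>b\<in>Basis. f b *\<^sub>R b) $ i = (\<Sum>b\<in>Basis. f b *\<^sub>R b) \<bullet> axis i 1"
        by (simp add: inner_axis)
      also have "\<dots> = f (axis i 1)"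
        by (rule inner_sum_left_Basis) (simp add: basis_3)
      finally show ?thesis .
    qed
    then show ?thesis
      by (simp add: basis_3 prod.reindex[OF inj] g_def ix)
  qed
  have "has_bochner_integral (Pi\<^sub>M Basis (\<lambda>b :: real ^ 3. lborel)) (\<lambda>f. \<Prod>b\<in>Basis. g b (f b)) (\<Prod>b\<in>Basis. I (ix b))"
    using P.product_integrable_prod[of Basis g] P.product_integral_prod[of Basis g] int
    by (auto simp: has_bochner_integral_iff val)
  moreover have "(\<Prod>b\<in>Basis. I (ix b)) = (\<Prod>i\<in>UNIV. I i)"
    by (simp add: basis_3 prod.reindex[OF inj] ix)
  ultimately have "has_bochner_integral (Pi\<^sub>M Basis (\<lambda>b :: real ^ 3. lborel)) 
     (\<lambda>f. (\<lambda>x. \<Prod>i\<in>UNIV. h i (x $ i)) (\<Sum>b\<in>Basis. f b *\<^sub>R b)) (\<Prod>i\<in>UNIV. I i)"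
    by (simp only: eq)
  moreover have "(\<lambda>x :: real ^ 3. \<Prod>i\<in>UNIV. h i (x $ i)) \<in> borel_measurable borel"
    by (intro borel_measurable_prod meas)
  moreover have "(\<lambda>f. \<Sum>b\<in>Basis. f b *\<^sub>R b) \<in> Pi\<^sub>M Basis (\<lambda>b :: real ^ 3. lborel) \<rightarrow>\<^sub>M borel"
    by measurable
  ultimately show ?thesis
    by (subst lborel_eq) (rule has_bochner_integral_distr)
qed

text \<open>In polar coordinates, integrating a homogeneous polynomial against this density gives
  its integral over the sphere times a positive constant depending on the degree. Orthogonality and
  positivity on the sphere therefore have equivalent Gaussian forms, and the Gaussian integrals
  factor into one-dimensional moments.\<close>

definition gauss_density :: "real ^ 3 \<Rightarrow> real" where
  "gauss_density x = (\<Prod>i\<in>UNIV. std_normal_density (x $ i))"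

definition gauss_expectation :: "(real ^ 3 \<Rightarrow> real) \<Rightarrow> real" where
  "gauss_expectation p = (\<integral>x. p x * gauss_density x \<partial>lborel)"

definition normal_moment :: "nat \<Rightarrow> real" where
  "normal_moment k = (\<integral>x. std_normal_density x * x ^ k \<partial>lborel)"

lemma normal_moment_1: "normal_moment (Suc 0) = 0"
  using integral_std_normal_moment_odd[of 0] by (simp add: normal_moment_def)

text \<open>Integration by parts in one dimension, read off from the closed form of the even
  moments; for odd \<open>k\<close> both sides vanish.\<close>

lemma normal_moment_rec: "normal_moment (Suc (Suc k)) = real (Suc k) * normal_moment k"
proof (cases "even k")
  case True
  then obtain m where k: "k = 2 * m" by (elim evenE)
  have even: "normal_moment (2 * m) = fact (2 * m) / (2 ^ m * fact m)" for m
    unfolding normal_moment_def by (rule integral_std_normal_moment_even)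
  from even[of "Suc m"] have "normal_moment (Suc (Suc (2 * m))) =
      (2 * (real m + 1)) * real (Suc (2 * m)) * fact (2 * m) / (2 * 2 ^ m * ((real m + 1) * fact m))"
    by (simp add: algebra_simps)
  also have "\<dots> = real (Suc (2 * m)) * (fact (2 * m) / (2 ^ m * fact m))"
    by (simp add: divide_simps)
  finally show ?thesis using even[of m] by (simp add: k)
next
  case False
  then obtain m where k: "k = 2 * m + 1" by (elim oddE)
  have "normal_moment (2 * m + 1) = 0" for m
    unfolding normal_moment_def by (rule integral_std_normal_moment_odd)
  from this[of m] this[of "Suc m"] show ?thesis by (simp add: k)
qed

definition monomial3 :: "(3 \<Rightarrow> nat) \<Rightarrow> real ^ 3 \<Rightarrow> real" where
  "monomial3 e x = (\<Prod>i\<in>UNIV. x $ i ^ e i)"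

lemma has_bochner_integral_monomial3:
  "has_bochner_integral lborel (\<lambda>x. monomial3 e x * gauss_density x) (\<Prod>i\<in>UNIV. normal_moment (e i))"
proof -
  have "has_bochner_integral lborel (\<lambda>t. std_normal_density t * t ^ e i) (normal_moment (e i))" for i
    using integrable_std_normal_moment[of "e i"] by (simp add: has_bochner_integral_iff normal_moment_def)
  from has_bochner_integral_lborel_prod[of "\<lambda>i t. std_normal_density t * t ^ e i", OF this]
  show ?thesis by (simp add: monomial3_def gauss_density_def prod.distrib mult.commute)
qed

lemma prod_UNIV_remove: "(\<Prod>j\<in>UNIV. f j) = f i * (\<Prod>j\<in>UNIV - {i}. f j)"
  for f :: "'i::finite \<Rightarrow> 'a::comm_monoid_mult"
  by (rule prod.remove[of UNIV i f]) simp_all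

lemma monomial3_upd: "monomial3 (e(i := k)) x = x $ i ^ k * (\<Prod>j\<in>UNIV - {i}. x $ j ^ e j)"
proof -
  have "(\<Prod>j\<in>UNIV - {i}. x $ j ^ (e(i := k)) j) = (\<Prod>j\<in>UNIV - {i}. x $ j ^ e j)"
    by (rule prod.cong) auto
  then show ?thesis unfolding monomial3_def prod_UNIV_remove[where i = i] by simp
qed

lemma coord_monomial3: "x $ i * monomial3 e x = monomial3 (e(i := Suc (e i))) x"
proof -
  have "monomial3 e x = x $ i ^ e i * (\<Prod>j\<in>UNIV - {i}. x $ j ^ e j)"
    using monomial3_upd[of e i "e i" x] by (simp only: fun_upd_triv)
  then show ?thesis by (simp only: monomial3_upd power_Suc mult.assoc)
qed

lemma prod_UNIV_3: "prod f (UNIV :: 3 set) = f 1 * f 2 * f 3"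
proof -
  have "(1::3) \<noteq> 2" "(1::3) \<noteq> 3" "(2::3) \<noteq> 3" by simp_all
  then show ?thesis unfolding UNIV_3 by (simp add: mult.assoc)
qed

lemma homog_poly_monomial3: "homog_poly (\<Sum>i\<in>UNIV. e i) (monomial3 e)"
proof -
  have "homog_poly (1 * e i) (\<lambda>x. x $ i ^ e i)" for i
    by (rule homog_poly_power[OF homog_poly_component])
  then have c: "homog_poly (e i) (\<lambda>x. x $ i ^ e i)" for i by simp
  have h: "homog_poly (e 1 + e 2 + e 3) (\<lambda>x. x $ 1 ^ e 1 * x $ 2 ^ e 2 * x $ 3 ^ e 3)"
    by (rule homog_poly_mult[OF homog_poly_mult[OF c c] c])
  have eq: "monomial3 e = (\<lambda>x. x $ 1 ^ e 1 * x $ 2 ^ e 2 * x $ 3 ^ e 3)"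
    unfolding monomial3_def prod_UNIV_3 ..
  show ?thesis unfolding sum_3 eq by (rule h)
qed

text \<open>Gaussian integrals can be computed on monomials, but they do not behave well under
  multiplication by a coordinate. This turns the generation of \<open>homog_poly\<close> into
  induction over monomials and sums.\<close>

lemma homog_poly_monomial_induct [consumes 1, case_names monomial add]:
  assumes "homog_poly d p"
    and "\<And>c e. (\<Sum>i\<in>UNIV. e i) = d \<Longrightarrow> P (\<lambda>x. c * monomial3 e x)"
    and "\<And>p q. homog_poly d p \<Longrightarrow> homog_poly d q \<Longrightarrow> P p \<Longrightarrow> P q \<Longrightarrow> P (\<lambda>x. p x + q x)"
  shows "P p"
  using assms
proof (induction arbitrary: P rule: homog_poly.induct)
  case (const c)
  from const.prems(1)[of "\<lambda>_. 0" c] show ?case by (simp add: monomial3_def[abs_def])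
next
  case (add d p q)
  show ?case
    by (rule add.prems(2)[OF add.hyps add.IH(1)[OF add.prems] add.IH(2)[OF add.prems]])
next
  case (coord d p i)
  have "P (\<lambda>x. x $ i * p x) \<and> homog_poly d p"
  proof (rule coord.IH[of "\<lambda>p. P (\<lambda>x. x $ i * p x) \<and> homog_poly d p"])
    fix c :: real and e :: "3 \<Rightarrow> nat"
    assume 1: "(\<Sum>i\<in>UNIV. e i) = d"
    have eq: "(\<lambda>x. x $ i * (c * monomial3 e x)) = (\<lambda>x. c * monomial3 (e(i := Suc (e i))) x)"
      by (simp only: coord_monomial3[symmetric] mult.left_commute)
    have "(\<Sum>j\<in>UNIV. (e(i := Suc (e i))) j) = Suc d"
    proof -
      have "(\<Sum>j\<in>UNIV. (e(i := Suc (e i))) j) = (\<Sum>j\<in>UNIV. e j + (if j = i then 1 else 0))"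
        by (rule sum.cong) auto
      then show ?thesis using 1 by (simp add: sum.distrib)
    qed
    then have "P (\<lambda>x. c * monomial3 (e(i := Suc (e i))) x)" by (rule coord.prems(1))
    moreover have "homog_poly d (\<lambda>x. c * monomial3 e x)"
      using homog_poly_scale[OF homog_poly_monomial3[of e]] unfolding 1 .
    ultimately show "P (\<lambda>x. x $ i * (c * monomial3 e x)) \<and> homog_poly d (\<lambda>x. c * monomial3 e x)"
      unfolding eq ..
  next
    fix p q
    assume pq: "homog_poly d p" "homog_poly d q" "P (\<lambda>x. x $ i * p x) \<and> homog_poly d p"
      "P (\<lambda>x. x $ i * q x) \<and> homog_poly d q"
    have "P (\<lambda>x. x $ i * p x + x $ i * q x)"
      by (rule coord.prems(2)) (use pq in \<open>auto intro: homog_poly.coord\<close>)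
    then show "P (\<lambda>x. x $ i * (p x + q x)) \<and> homog_poly d (\<lambda>x. p x + q x)"
      using homog_poly.add[OF pq(1,2)] by (simp add: distrib_left)
  qed
  then show ?case by simp
qed

lemma homog_poly_gauss_integrable:
  "homog_poly d p \<Longrightarrow> integrable lborel (\<lambda>x. p x * gauss_density x)"
proof (induction rule: homog_poly_monomial_induct)
  case (monomial c e)
  have "integrable lborel (\<lambda>x. monomial3 e x * gauss_density x)"
    using has_bochner_integral_monomial3 by (simp add: has_bochner_integral_iff)
  then show ?case by (simp add: mult.assoc)
next
  case (add p q)
  then show ?case by (simp add: distrib_right)
qed

lemma gauss_expectation_add:
  assumes "homog_poly d p" "homog_poly e q"
  shows "gauss_expectation (\<lambda>x. p x + q x) = gauss_expectation p + gauss_expectation q"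
  using assms[THEN homog_poly_gauss_integrable] by (simp add: gauss_expectation_def distrib_right)

lemma gauss_expectation_scale: "gauss_expectation (\<lambda>x. c * p x) = c * gauss_expectation p"
  by (simp add: gauss_expectation_def mult.assoc)

lemma gauss_expectation_zero [simp]: "gauss_expectation (\<lambda>x. 0) = 0"
  by (simp add: gauss_expectation_def)

lemma gauss_expectation_sum:
  "(\<And>i. i \<in> I \<Longrightarrow> homog_poly d (f i)) \<Longrightarrow>
    gauss_expectation (\<lambda>x. \<Sum>i\<in>I. f i x) = (\<Sum>i\<in>I. gauss_expectation (f i))"
proof (induction I rule: infinite_finite_induct)
  case (insert i I)
  have "gauss_expectation (\<lambda>x. f i x + (\<Sum>i\<in>I. f i x)) = 
      gauss_expectation (f i) + gauss_expectation (\<lambda>x. \<Sum>i\<in>I. f i x)"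
    by (rule gauss_expectation_add[of d _ d]) (use insert.prems in \<open>auto intro: homog_poly_sum\<close>)
  then show ?case using insert by simp
qed simp_all

lemma gauss_expectation_monomial3: "gauss_expectation (monomial3 e) = (\<Prod>i\<in>UNIV. normal_moment (e i))"
  using has_bochner_integral_monomial3 by (simp add: gauss_expectation_def has_bochner_integral_iff)

lemma pderiv3_monomial3: "pderiv3 i (monomial3 e) x = real (e i) * monomial3 (e(i := e i - 1)) x"
proof -
  let ?R = "\<lambda>x :: real ^ 3. \<Prod>j\<in>UNIV - {i}. x $ j ^ e j"
  have comp: "((\<lambda>x. x $ j) has_derivative (\<lambda>h. h $ j)) (at x)" for j
    by (rule bounded_linear_imp_has_derivative) (rule bounded_linear_vec_nth)
  have "(?R has_derivative (\<lambda>h. \<Sum>j\<in>UNIV - {i}. (real (e j) * h $ j * x $ j ^ (e j - 1)) *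
           (\<Prod>k\<in>UNIV - {i} - {j}. x $ k ^ e k))) (at x)"
    by (intro has_derivative_prod) (auto intro!: has_derivative_eq_rhs[OF has_derivative_power[OF comp]])
  from has_derivative_mult[OF has_derivative_power[OF comp[of i], of "e i"] this]
  have "((\<lambda>x. x $ i ^ e i * ?R x) has_derivative
     (\<lambda>h. x $ i ^ e i * (\<Sum>j\<in>UNIV - {i}. (real (e j) * h $ j * x $ j ^ (e j - 1)) *
           (\<Prod>k\<in>UNIV - {i} - {j}. x $ k ^ e k)) + of_nat (e i) * h $ i * x $ i ^ (e i - 1) * ?R x)) (at x)"
    by simp
  moreover have "(\<lambda>x. x $ i ^ e i * ?R x) = monomial3 e"
    using monomial3_upd[of e i "e i"] by (simp add: fun_eq_iff)
  ultimately have "pderiv3 i (monomial3 e) x = x $ i ^ e i * (\<Sum>j\<in>UNIV - {i}. (real (e j) * axis i 1 $ j * x $ j ^ (e j - 1)) *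
           (\<Prod>k\<in>UNIV - {i} - {j}. x $ k ^ e k)) + of_nat (e i) * axis i 1 $ i * x $ i ^ (e i - 1) * ?R x"
    by (simp add: pderiv3_eqI)
  also have "(\<Sum>j\<in>UNIV - {i}. (real (e j) * axis i 1 $ j * x $ j ^ (e j - 1)) *
           (\<Prod>k\<in>UNIV - {i} - {j}. x $ k ^ e k)) = 0"
    by (intro sum.neutral) (auto simp: axis_def)
  also have "real (e i) * axis i 1 $ i * x $ i ^ (e i - 1) * ?R x = real (e i) * monomial3 (e(i := e i - 1)) x"
    by (simp add: monomial3_upd axis_def)
  finally show ?thesis by simp
qed

text \<open>Stein's identity. On a monomial only the moment belonging to coordinate \<open>i\<close>
  changes, and there it is the recursion for moments.\<close>

lemma gauss_expectation_by_parts: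
  "homog_poly d p \<Longrightarrow> gauss_expectation (\<lambda>x. x $ i * p x) = gauss_expectation (pderiv3 i p)"
proof (induction rule: homog_poly_monomial_induct)
  case (monomial c e)
  let ?R = "\<Prod>j\<in>UNIV - {i}. normal_moment (e j)"
  have upd: "(\<Prod>j\<in>UNIV. normal_moment ((e(i := k)) j)) = normal_moment k * ?R" for k
  proof -
    have "(\<Prod>j\<in>UNIV - {i}. normal_moment ((e(i := k)) j)) = ?R" by (rule prod.cong) auto
    then show ?thesis unfolding prod_UNIV_remove[where i = i] by simp
  qed
  have "gauss_expectation (\<lambda>x. x $ i * monomial3 e x) = normal_moment (Suc (e i)) * ?R"
    unfolding coord_monomial3
    using gauss_expectation_monomial3[of "e(i := Suc (e i))"] upd[of "Suc (e i)"] by simp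
  \<comment> \<open>For \<open>e i = 0\<close> both sides vanish: the left one by the first moment,
    the right one by the factor \<open>real (e i)\<close>.\<close>
  also have "\<dots> = real (e i) * (normal_moment (e i - 1) * ?R)"
    by (cases "e i") (simp_all add: normal_moment_1 normal_moment_rec)
  also have "\<dots> = gauss_expectation (pderiv3 i (monomial3 e))"
    unfolding upd[symmetric] pderiv3_monomial3[abs_def] gauss_expectation_scale
    by (simp only: gauss_expectation_monomial3)
  finally show ?case
    using gauss_expectation_scale[of c "\<lambda>x. x $ i * monomial3 e x"] gauss_expectation_scale[of c "pderiv3 i (monomial3 e)"]
    by (simp add: pderiv3_scale[OF homog_poly_monomial3] mult.left_commute)
next
  case (add p q)
  then show ?case
    by (simp add: distrib_left pderiv3_add[OF add.hyps] 
      gauss_expectation_add[OF homog_poly.coord homog_poly.coord, OF add.hyps]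
      gauss_expectation_add[OF homog_poly_pderiv3 homog_poly_pderiv3, OF add.hyps])
qed

text \<open>Euler's identity writes n p as the sum of x_i times the i-th derivative of p, and
  Stein's identity turns each x_i into a derivative of the product. The second derivatives of p add
  up to the Laplacian, and the products of first derivatives are instances in degrees n - 1 and m -
  1, where the gap persists; for m = 0 they vanish.\<close>

lemma harmonic_poly_orthogonal:
  assumes "harmonic_poly n p" "homog_poly m q" "m < n"
  shows "gauss_expectation (\<lambda>x. p x * q x) = 0"
  using assms
proof (induction n arbitrary: m p q)
  case (Suc n)
  have hp: "homog_poly (Suc n) p" using Suc.prems by (simp add: harmonic_poly_def)
  have hq: "homog_poly m q" by fact
  note D = homog_poly_pderiv3[OF hp]
  note Dq = homog_poly_pderiv3[OF hq]
  have "real (Suc n) * gauss_expectation (\<lambda>x. p x * q x)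
      = gauss_expectation (\<lambda>x. \<Sum>i\<in>UNIV. x $ i * (pderiv3 i p x * q x))"
  proof -
    have "(\<lambda>x. \<Sum>i\<in>UNIV. x $ i * (pderiv3 i p x * q x)) = (\<lambda>x. real (Suc n) * (p x * q x))"
      unfolding mult.assoc[symmetric] euler_homog_poly[OF hp, symmetric] sum_distrib_right ..
    then show ?thesis by (simp only: gauss_expectation_scale)
  qed
  also have "\<dots> = (\<Sum>i\<in>UNIV. gauss_expectation (\<lambda>x. x $ i * (pderiv3 i p x * q x)))"
    by (rule gauss_expectation_sum[OF homog_poly.coord[OF homog_poly_mult[OF D hq]]])
  also have "\<dots> = (\<Sum>i\<in>UNIV. gauss_expectation (\<lambda>x. pderiv3 i (pderiv3 i p) x * q x + pderiv3 i p x * pderiv3 i q x))"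
    by (simp add: gauss_expectation_by_parts[OF homog_poly_mult[OF D hq]] pderiv3_mult[OF D hq])
  also have "\<dots> = (\<Sum>i\<in>UNIV. gauss_expectation (\<lambda>x. pderiv3 i (pderiv3 i p) x * q x))
       + (\<Sum>i\<in>UNIV. gauss_expectation (\<lambda>x. pderiv3 i p x * pderiv3 i q x))"
    by (simp add: gauss_expectation_add[OF homog_poly_mult[OF homog_poly_pderiv3[OF D] hq] homog_poly_mult[OF D Dq]]
        sum.distrib)
  also have "(\<Sum>i\<in>UNIV. gauss_expectation (\<lambda>x. pderiv3 i (pderiv3 i p) x * q x))
     = gauss_expectation (\<lambda>x. (\<Sum>i\<in>UNIV. pderiv3 i (pderiv3 i p) x) * q x)"
    unfolding sum_distrib_right
    by (rule gauss_expectation_sum[symmetric]) (rule homog_poly_mult[OF homog_poly_pderiv3[OF D] hq])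
  also have "\<dots> = 0" using Suc.prems(1) by (simp add: harmonic_poly_def)
  also have "(\<Sum>i\<in>UNIV. gauss_expectation (\<lambda>x. pderiv3 i p x * pderiv3 i q x)) = 0"
  proof (intro sum.neutral ballI)
    fix i :: 3
    show "gauss_expectation (\<lambda>x. pderiv3 i p x * pderiv3 i q x) = 0"
    proof (cases m)
      case 0
      then have "pderiv3 i q = (\<lambda>x. 0)" using hq pderiv3_degree_0 by simp
      then show ?thesis by simp
    next
      case (Suc k)
      then show ?thesis
        using Suc.IH[of "pderiv3 i p" "m - 1" "pderiv3 i q"] harmonic_poly_pderiv3[OF Suc.prems(1), of i] Dq
          Suc.prems by simp
    qed
  qed
  finally show ?case by simp
qed simp

lemma gauss_expectation_pos:
  assumes "homog_poly d p" "\<And>x. p x \<ge> 0" "p a > 0"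
  shows "gauss_expectation p > 0"
proof -
  let ?f = "\<lambda>x. p x * gauss_density x"
  have gpos: "gauss_density x > 0" for x unfolding gauss_density_def by (intro prod_pos) (simp add: normal_density_pos)
  have int: "integrable lborel ?f" using assms by (rule_tac homog_poly_gauss_integrable)
  have nn: "?f x \<ge> 0" for x using assms(2)[of x] gpos[of x] by simp
  have "gauss_expectation p \<ge> 0"
    unfolding gauss_expectation_def by (intro integral_nonneg_AE AE_I2 nn)
  moreover have "gauss_expectation p \<noteq> 0"
  proof
    assume "gauss_expectation p = 0"
    then have "AE x in lborel. ?f x = 0"
      unfolding gauss_expectation_def using integral_nonneg_eq_0_iff_AE[OF int] nn by simp
    then have ae: "AE x in lborel. x \<notin> {x. p x > 0}"
    proof eventually_elim
      case (elim x)
      then show ?case using gpos[of x] by simp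
    qed
    have op: "open {x. p x > 0}"
      using homog_poly_continuous_on[OF assms(1), of UNIV] by (auto intro: open_Collect_less continuous_on_const)
    then have "{x. p x > 0} \<in> null_sets lborel"
      using ae by (subst AE_iff_null_sets) (auto simp: borel_open)
    then have "negligible {x. p x > 0}" using null_sets_completionI negligible_iff_null_sets by blast
    then show False using open_not_negligible[OF op] assms(3) by auto
  qed
  ultimately show ?thesis by simp
qed

section \<open>Affine charts of the sphere\<close>

definition orthonormal_frame :: "(3 \<Rightarrow> real ^ 3) \<Rightarrow> bool" where
  "orthonormal_frame e \<longleftrightarrow> (\<forall>i j. e i \<bullet> e j = (if i = j then 1 else 0)) \<and>
     (\<forall>x. x = (x \<bullet> e 1) *\<^sub>R e 1 + (x \<bullet> e 2) *\<^sub>R e 2 + (x \<bullet> e 3) *\<^sub>R e 3)"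

lemma orthonormal_frame_axis: "orthonormal_frame (\<lambda>i. axis i 1)"
  unfolding orthonormal_frame_def
proof (intro conjI allI)
  show "(axis i 1 :: real ^ 3) \<bullet> axis j 1 = (if i = j then 1 else 0)" for i j
    by (simp add: inner_axis_axis)
  show "x = (x \<bullet> axis 1 1) *\<^sub>R axis 1 1 + (x \<bullet> axis 2 1) *\<^sub>R axis 2 1 + (x \<bullet> axis 3 1) *\<^sub>R axis 3 1"
    for x :: "real ^ 3"
    by (simp add: vec_eq_iff inner_axis forall_3) (simp add: axis_def)
qed

lemma orthonormal_frame_transform:
  assumes "orthogonal_transformation f" "orthonormal_frame e"
  shows "orthonormal_frame (\<lambda>i. f (e i))"
  unfolding orthonormal_frame_def
proof (intro conjI allI)
  fix i j
  show "f (e i) \<bullet> f (e j) = (if i = j then 1 else 0)"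
    using assms by (simp add: orthogonal_transformation_def orthonormal_frame_def)
next
  fix x
  have lin: "linear f" using assms(1) by (rule orthogonal_transformation_linear)
  have "surj f" using assms(1) by (rule orthogonal_transformation_surj)
  then obtain y where y: "x = f y" by auto
  have inner: "y \<bullet> e i = x \<bullet> f (e i)" for i
    using assms(1) y by (simp add: orthogonal_transformation_def)
  have "y = (y \<bullet> e 1) *\<^sub>R e 1 + (y \<bullet> e 2) *\<^sub>R e 2 + (y \<bullet> e 3) *\<^sub>R e 3"
    using assms(2) unfolding orthonormal_frame_def by blast
  then have "f y = f ((y \<bullet> e 1) *\<^sub>R e 1 + (y \<bullet> e 2) *\<^sub>R e 2 + (y \<bullet> e 3) *\<^sub>R e 3)" by simp
  also have "\<dots> = (y \<bullet> e 1) *\<^sub>R f (e 1) + (y \<bullet> e 2) *\<^sub>R f (e 2) + (y \<bullet> e 3) *\<^sub>R f (e 3)"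
    by (simp add: linear_add[OF lin] linear_cmul[OF lin])
  finally show "x = (x \<bullet> f (e 1)) *\<^sub>R f (e 1) + (x \<bullet> f (e 2)) *\<^sub>R f (e 2) + (x \<bullet> f (e 3)) *\<^sub>R f (e 3)"
    unfolding inner y .
qed

lemma orthonormal_frame_inner:
  "orthonormal_frame e \<Longrightarrow> e i \<bullet> e j = (if i = j then 1 else 0)"
  by (simp add: orthonormal_frame_def)

lemma orthonormal_frame_expand:
  "orthonormal_frame e \<Longrightarrow> (x \<bullet> e 1) *\<^sub>R e 1 + (x \<bullet> e 2) *\<^sub>R e 2 + (x \<bullet> e 3) *\<^sub>R e 3 = x"
  by (simp add: orthonormal_frame_def)

lemma ex_orthonormal_frame_avoiding:
  assumes "finite C" "0 \<notin> C"
  shows "\<exists>e. orthonormal_frame e \<and> (\<forall>p\<in>C. p \<bullet> e 3 \<noteq> 0)"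
proof -
  \<comment> \<open>Each point excludes only finitely many vectors of the moment curve.\<close>
  have "finite {t. (p :: real ^ 3) $ 1 + p $ 2 * t + p $ 3 * t\<^sup>2 = 0}" if "p \<in> C" for p
  proof -
    have "p \<noteq> 0" using assms that by auto
    then have "[:p $ 1, p $ 2, p $ 3:] \<noteq> 0" by (auto simp: vec_eq_iff forall_3)
    then have "finite {t. poly [:p $ 1, p $ 2, p $ 3:] t = 0}" by (rule poly_roots_finite)
    moreover have "poly [:p $ 1, p $ 2, p $ 3:] t = p $ 1 + p $ 2 * t + p $ 3 * t\<^sup>2" for t
      by (simp add: algebra_simps power2_eq_square)
    ultimately show ?thesis by (simp only:)
  qed
  then have fin: "finite (\<Union>p\<in>C. {t. p $ 1 + p $ 2 * t + p $ 3 * t\<^sup>2 = 0})" using assms by blast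
  obtain t where t: "t \<notin> (\<Union>p\<in>C. {t. p $ 1 + p $ 2 * t + p $ 3 * t\<^sup>2 = 0})"
    using ex_new_if_finite[OF infinite_UNIV_char_0 fin] by blast
  define v :: "real ^ 3" where "v = vector [1, t, t\<^sup>2]"
  have pv: "p \<bullet> v = p $ 1 + p $ 2 * t + p $ 3 * t\<^sup>2" for p
    by (simp add: v_def inner_vec_def sum_3)
  have "v $ 1 = 1" by (simp add: v_def)
  then have "v \<noteq> 0" by auto
  then have nv: "norm (v /\<^sub>R norm v) = 1" by simp
  have na: "norm (axis 3 1 :: real ^ 3) = 1" by simp
  obtain f :: "real ^ 3 \<Rightarrow> real ^ 3" where f: "orthogonal_transformation f" "f (axis (3::3) 1) = v /\<^sub>R norm v"
    using orthogonal_transformation_exists_1[OF na nv] by blast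
  have "p \<bullet> f (axis 3 1) \<noteq> 0" if "p \<in> C" for p
    using t that \<open>v \<noteq> 0\<close> by (auto simp: f pv)
  then show ?thesis using orthonormal_frame_transform[OF f(1) orthonormal_frame_axis] by blast
qed

definition frame_chart :: "(3 \<Rightarrow> real ^ 3) \<Rightarrow> real \<Rightarrow> real \<Rightarrow> real ^ 3" where
  "frame_chart e s t = s *\<^sub>R e 1 + t *\<^sub>R e 2 + e 3"

lemma frame_chart_inner:
  assumes "orthonormal_frame e"
  shows "frame_chart e s t \<bullet> e 1 = s" "frame_chart e s t \<bullet> e 2 = t" "frame_chart e s t \<bullet> e 3 = 1"
  by (simp_all add: frame_chart_def inner_add_left orthonormal_frame_inner[OF assms])

lemma eq_scaleR_frame_chart:
  assumes "orthonormal_frame e" "x \<bullet> e 3 \<noteq> 0"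
  shows "x = (x \<bullet> e 3) *\<^sub>R frame_chart e (x \<bullet> e 1 / (x \<bullet> e 3)) (x \<bullet> e 2 / (x \<bullet> e 3))"
  using orthonormal_frame_expand[OF assms(1), of x] assms(2)
  by (simp add: frame_chart_def scaleR_add_right)

definition pulls_back_to :: "(real ^ 3 \<Rightarrow> real) \<Rightarrow> (3 \<Rightarrow> real ^ 3) \<Rightarrow> real poly poly \<Rightarrow> bool" where
  "pulls_back_to p e P \<longleftrightarrow> (\<forall>s t. p (frame_chart e s t) = eval2 P s t)"

lemma ex_pull_back:
  "homog_poly d p \<Longrightarrow> \<exists>P. total_degree_le P d \<and> pulls_back_to p e P"
proof (induction rule: homog_poly.induct)
  case (const c)
  show ?case
    by (intro exI[of _ "[:[:c:]:]"])
       (auto simp: pulls_back_to_def total_degree_le_def coeff_pCons split: nat.splits)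
next
  case (add d p q)
  then obtain P Q where "total_degree_le P d" "pulls_back_to p e P" "total_degree_le Q d" "pulls_back_to q e Q"
    by blast
  then show ?case by (intro exI[of _ "P + Q"]) (auto simp: pulls_back_to_def intro: total_degree_le_add)
next
  case (coord d p i)
  then obtain P where P: "total_degree_le P d" "pulls_back_to p e P" by blast
  define L where "L = monom (monom (e 1 $ i) 1) 0 + monom (monom (e 2 $ i) 0) 1 + monom (monom (e 3 $ i) 0) 0"
  have L: "total_degree_le L 1"
    unfolding L_def by (intro total_degree_le_add total_degree_le_monom) auto
  have "eval2 L s t = frame_chart e s t $ i" for s t
    by (simp add: L_def frame_chart_def mult.commute)
  then show ?case
    using P total_degree_le_mult[OF L P(1)] by (intro exI[of _ "L * P"]) (auto simp: pulls_back_to_def)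
qed

lemma homog_poly_scaleR: "homog_poly d p \<Longrightarrow> p (c *\<^sub>R x) = c ^ d * p x"
  by (induction rule: homog_poly.induct) (auto simp: algebra_simps)

lemma homog_poly_eq_eval2:
  assumes "homog_poly d p" "orthonormal_frame e" "pulls_back_to p e P" "x \<bullet> e 3 \<noteq> 0"
  shows "p x = (x \<bullet> e 3) ^ d * eval2 P (x \<bullet> e 1 / (x \<bullet> e 3)) (x \<bullet> e 2 / (x \<bullet> e 3))"
  using arg_cong[OF eq_scaleR_frame_chart[OF assms(2,4)], of p] homog_poly_scaleR[OF assms(1)] assms(3)
  by (simp add: pulls_back_to_def)

text \<open>The degree \<open>m\<close> may exceed the total degree of \<open>P\<close>; each
  additional degree contributes a factor \<open>x \<bullet> e 3\<close>. This freedom is used to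
  adjust parity.\<close>

lemma ex_homogenization:
  assumes "total_degree_le P m"
  shows "\<exists>H. homog_poly m H \<and> (\<forall>x. x \<bullet> e 3 \<noteq> 0 \<longrightarrow>
     H x = (x \<bullet> e 3) ^ m * eval2 P (x \<bullet> e 1 / (x \<bullet> e 3)) (x \<bullet> e 2 / (x \<bullet> e (3 :: 3))))"
proof -
  define H where "H = (\<lambda>x :: real ^ 3. \<Sum>ij\<in>bidegrees m. coeff (coeff P (snd ij)) (fst ij) *
     ((x \<bullet> e 1) ^ fst ij * ((x \<bullet> e 2) ^ snd ij * (x \<bullet> e 3) ^ (m - fst ij - snd ij))))"
  have "homog_poly m H"
    unfolding H_def
  proof (intro homog_poly_sum homog_poly_scale)
    fix ij assume "ij \<in> bidegrees m"
    then have "1 * fst ij + (1 * snd ij + 1 * (m - fst ij - snd ij)) = m" by (auto simp: bidegrees_def)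
    moreover have "homog_poly (1 * fst ij + (1 * snd ij + 1 * (m - fst ij - snd ij)))
       (\<lambda>x. (x \<bullet> e 1) ^ fst ij * ((x \<bullet> e 2) ^ snd ij * (x \<bullet> e 3) ^ (m - fst ij - snd ij)))"
      by (intro homog_poly_mult homog_poly_power homog_poly_inner)
    ultimately show "homog_poly m
       (\<lambda>x. (x \<bullet> e 1) ^ fst ij * ((x \<bullet> e 2) ^ snd ij * (x \<bullet> e 3) ^ (m - fst ij - snd ij)))" by simp
  qed
  moreover have "H x = (x \<bullet> e 3) ^ m * eval2 P (x \<bullet> e 1 / (x \<bullet> e 3)) (x \<bullet> e 2 / (x \<bullet> e 3))"
    if x: "x \<bullet> e 3 \<noteq> 0" for x
    unfolding H_def eval2_eq_sum[OF assms] sum_distrib_left case_prod_unfold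
  proof (intro sum.cong refl)
    fix ij assume "ij \<in> bidegrees m"
    then have "m = fst ij + snd ij + (m - fst ij - snd ij)" by (auto simp: bidegrees_def)
    then have "(x \<bullet> e 3) ^ m = (x \<bullet> e 3) ^ fst ij * (x \<bullet> e 3) ^ snd ij * (x \<bullet> e 3) ^ (m - fst ij - snd ij)"
      by (metis power_add)
    then show "coeff (coeff P (snd ij)) (fst ij) *
         ((x \<bullet> e 1) ^ fst ij * ((x \<bullet> e 2) ^ snd ij * (x \<bullet> e 3) ^ (m - fst ij - snd ij))) =
       (x \<bullet> e 3) ^ m * (coeff (coeff P (snd ij)) (fst ij) * (x \<bullet> e 1 / (x \<bullet> e 3)) ^ fst ij *
         (x \<bullet> e 2 / (x \<bullet> e 3)) ^ snd ij)"
      using x by (simp add: power_divide)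
  qed
  ultimately show ?thesis by blast
qed

text \<open>A nonconstant affine function takes negative values. Excluding degree 1 leaves room to
  raise the degree of the cofactor by one and still stay below the degree of the harmonic
  polynomial.\<close>

lemma nonneg_eval2_total_degree_neq_1:
  fixes w :: "real poly poly"
  assumes "\<And>x y. eval2 w x y \<ge> 0"
  shows "total_degree w \<noteq> 1"
proof
  assume 1: "total_degree w = 1"
  define a where "a = coeff (coeff w 0) 0"
  define b where "b = coeff (coeff w 0) 1"
  define c where "c = coeff (coeff w 1) 0"
  have "bidegrees 1 = {(0,0), (0,1), (1,0)}" by (auto simp: bidegrees_def)
  then have ev: "eval2 w x y = a + b * x + c * y" for x y
    using eval2_eq_sum[OF total_degree_le_total_degree[of w], of x y]
    by (simp add: 1 a_def b_def c_def)
  \<comment> \<open>At the point supplied, and likewise for \<open>c\<close>, the affine function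
    would have the value -1.\<close>
  have "b = 0"
    using assms[of "- (a + 1) / b" 0] by (cases "b = 0") (auto simp: ev)
  moreover have "c = 0"
    using assms[of 0 "- (a + 1) / c"] by (cases "c = 0") (auto simp: ev)
  moreover obtain i j where "i + j = 1" "coeff (coeff w j) i \<noteq> 0"
    using total_degree_attained[of w] 1 by (force simp: total_degree_def)
  ultimately show False by (auto simp: b_def c_def add_is_1)
qed

text \<open>
  A nonconstant semidefinite factor \<open>w\<close> of \<open>f\<close> is impossible: with \<open>H\<close> the homogenization of the
  cofactor, raised by one degree if parity requires it, \<open>f * H\<close> would be nonnegative although
  \<open>H\<close> has smaller degree than \<open>f\<close> and hence is orthogonal to it.
\<close>
lemma harmonic_poly_semidefinite_factor:
  assumes e: "orthonormal_frame e" and f: "harmonic_poly n f"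
    and P: "pulls_back_to f e P" "total_degree_le P n" "P \<noteq> 0" "P = w * q"
    and nonneg: "\<And>x y. eval2 w x y \<ge> 0"
  shows "total_degree w = 0"
proof (rule ccontr)
  assume "total_degree w \<noteq> 0"
  then have d2: "total_degree w \<ge> 2" using nonneg_eval2_total_degree_neq_1[OF nonneg] by linarith
  have hf: "homog_poly n f" using f by (rule harmonic_polyD)
  have "w \<noteq> 0" "q \<noteq> 0" using P by auto
  then have deg: "total_degree w + total_degree q \<le> n"
    using P by (intro total_degree_mult_le) auto
  define m where "m = (if even (n + (n - total_degree w)) then n - total_degree w else n - total_degree w + 1)"
  have m: "m < n" "even (n + m)" "total_degree_le q m"
    using d2 deg total_degree_le_mono[OF total_degree_le_total_degree[of q]] by (auto simp: m_def)
  obtain H where H: "homog_poly m H" "\<And>x. x \<bullet> e 3 \<noteq> 0 \<Longrightarrow>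
     H x = (x \<bullet> e 3) ^ m * eval2 q (x \<bullet> e 1 / (x \<bullet> e 3)) (x \<bullet> e 2 / (x \<bullet> e 3))"
    using ex_homogenization[OF m(3), of e] by blast
  have hfH: "homog_poly (n + m) (\<lambda>x. f x * H x)" using hf H(1) by (rule homog_poly_mult)
  \<comment> \<open>The cofactor \<open>q\<close> enters through both \<open>f\<close> and
    \<open>H\<close> and hence as a square. Since \<open>n + m\<close> is even, \<open>w\<close>
    alone decides the sign.\<close>
  have val: "f x * H x = (x \<bullet> e 3) ^ (n + m) * (eval2 w (x \<bullet> e 1 / (x \<bullet> e 3)) (x \<bullet> e 2 / (x \<bullet> e 3)) *
      (eval2 q (x \<bullet> e 1 / (x \<bullet> e 3)) (x \<bullet> e 2 / (x \<bullet> e 3)))\<^sup>2)" if "x \<bullet> e 3 \<noteq> 0" for x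
    by (simp add: homog_poly_eq_eval2[OF hf e P(1) that] H(2)[OF that] P(4) power_add power2_eq_square)
  have nn1: "f x * H x \<ge> 0" if "x \<bullet> e 3 \<noteq> 0" for x
    unfolding val[OF that] using m(2) nonneg by (intro mult_nonneg_nonneg) (auto simp: zero_le_even_power)
  have nn: "f x * H x \<ge> 0" for x
  proof (cases "x \<bullet> e 3 = 0")
    case True
    \<comment> \<open>The chart says nothing about the plane \<open>x \<bullet> e 3 = 0\<close>; its
      points are approached from outside the plane.\<close>
    let ?y = "\<lambda>k. x + inverse (real (Suc k)) *\<^sub>R e 3"
    have "?y \<longlonglongrightarrow> x + 0 *\<^sub>R e 3"
      by (intro tendsto_intros LIMSEQ_inverse_real_of_nat)
    then have "(\<lambda>k. f (?y k) * H (?y k)) \<longlonglongrightarrow> f x * H x"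
      using homog_poly_continuous_on[OF hfH, of UNIV]
      by (intro continuous_on_tendsto_compose[of UNIV "\<lambda>x. f x * H x"]) auto
    moreover have "?y k \<bullet> e 3 \<noteq> 0" for k
      by (simp add: inner_add_left True orthonormal_frame_inner[OF e])
    ultimately show ?thesis using nn1 by (intro LIMSEQ_le_const) auto
  qed (rule nn1)
  obtain s t where st: "eval2 P s t \<noteq> 0" using eval2_eq_0_imp[of P] P(3) by blast
  then have "eval2 w s t > 0" "eval2 q s t \<noteq> 0" using nonneg[of s t] P(4) by auto
  then have "f (frame_chart e s t) * H (frame_chart e s t) > 0"
    using val[of "frame_chart e s t"] by (simp add: frame_chart_inner[OF e])
  with gauss_expectation_pos[OF hfH nn] have "gauss_expectation (\<lambda>x. f x * H x) > 0" by blast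
  then show False using harmonic_poly_orthogonal[OF f H(1) m(1)] by simp
qed

text \<open>The plane minus a finite set is connected, so with finitely many zeros the intermediate
  value theorem would give another zero outside them.\<close>

lemma infinite_zeros_if_sign_change:
  fixes w :: "real poly poly"
  assumes "eval2 w a b > 0" "eval2 w c d < 0"
  shows "infinite {(x, y). eval2 w x y = 0}"
proof
  let ?Z = "{(x, y). eval2 w x y = 0}"
  let ?g = "\<lambda>z :: real \<times> real. eval2 w (fst z) (snd z)"
  assume "finite ?Z"
  then have "connected (UNIV - ?Z)"
    by (intro connected_open_delete_finite) auto
  moreover have "continuous_on (UNIV - ?Z) ?g"
    unfolding eval2_eq_sum[OF total_degree_le_total_degree[of w]] case_prod_unfold
    by (intro continuous_intros)
  ultimately have "connected (?g ` (UNIV - ?Z))" by (rule connected_continuous_image[rotated])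
  moreover have "?g (c, d) \<in> ?g ` (UNIV - ?Z)" "?g (a, b) \<in> ?g ` (UNIV - ?Z)"
    using assms by (auto intro!: imageI simp del: fst_conv snd_conv)
  ultimately have "0 \<in> ?g ` (UNIV - ?Z)"
    by (rule connectedD_interval) (use assms in simp_all)
  then show False by auto
qed

section \<open>Critical points as common zeros of two angular derivatives\<close>

definition angular_derivative :: "real ^ 3 \<Rightarrow> real ^ 3 \<Rightarrow> (real ^ 3 \<Rightarrow> real) \<Rightarrow> real ^ 3 \<Rightarrow> real" where
  "angular_derivative a b u x =
     (x \<bullet> a) * frechet_derivative u (at x) b - (x \<bullet> b) * frechet_derivative u (at x) a"

text \<open>\<open>angular_derivative a b\<close> differentiates along the field
  \<open>(x \<bullet> a) *\<^sub>R b - (x \<bullet> b) *\<^sub>R a\<close>, which is tangent to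
  spheres. It is a combination of the coordinate rotations, so arbitrary frames need no rotation of
  \<open>u\<close>.\<close>

lemma harmonic_poly_angular_derivative:
  assumes "harmonic_poly n u"
  shows "harmonic_poly n (angular_derivative a b u)"
proof -
  have "angular_derivative a b u = (\<lambda>x. \<Sum>i\<in>UNIV. \<Sum>j\<in>UNIV.
      a $ i * b $ j * (x $ i * pderiv3 j u x - x $ j * pderiv3 i u x))"
  proof
    fix x
    show "angular_derivative a b u x = (\<Sum>i\<in>UNIV. \<Sum>j\<in>UNIV.
      a $ i * b $ j * (x $ i * pderiv3 j u x - x $ j * pderiv3 i u x))"
      unfolding angular_derivative_def homog_poly_frechet[OF harmonic_polyD[OF assms]] inner_vec_def sum_3
      by (simp add: algebra_simps)
  qed
  then show ?thesis
    using harmonic_poly_rotation[OF assms] by (auto intro!: harmonic_poly_sum harmonic_poly_scale)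
qed

definition real_sphere_critical_points :: "(real ^ 3 \<Rightarrow> real) \<Rightarrow> (real ^ 3) set" where
  "real_sphere_critical_points u =
     {p \<in> sphere 0 1. \<forall>v. v \<bullet> p = 0 \<longrightarrow> frechet_derivative u (at p) v = 0}"

lemma angular_derivative_critical:
  assumes "homog_poly n u" "p \<in> real_sphere_critical_points u"
  shows "angular_derivative a b u p = 0"
proof -
  interpret D: linear "frechet_derivative u (at p)"
    by (rule linear_frechet_derivative[OF homog_poly_differentiable[OF assms(1)]])
  have "((p \<bullet> a) *\<^sub>R b - (p \<bullet> b) *\<^sub>R a) \<bullet> p = 0"
    by (simp add: inner_diff_left inner_commute[of a p] inner_commute[of b p])
  then have "frechet_derivative u (at p) ((p \<bullet> a) *\<^sub>R b - (p \<bullet> b) *\<^sub>R a) = 0"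
    using assms(2) unfolding real_sphere_critical_points_def by blast
  then show ?thesis by (simp add: D.diff D.scale angular_derivative_def)
qed

text \<open>After division by \<open>p \<bullet> e 3\<close> the two equations say that the
  derivatives along the frame are proportional to the coordinates of \<open>p\<close>. The gradient
  is then parallel to \<open>p\<close> and annihilates the tangent space.\<close>

lemma critical_if_angular_derivatives_vanish:
  assumes "homog_poly n u" "orthonormal_frame e" "norm p = 1" "p \<bullet> e 3 \<noteq> 0"
    "angular_derivative (e 2) (e 3) u p = 0" "angular_derivative (e 3) (e 1) u p = 0"
  shows "p \<in> real_sphere_critical_points u"
proof -
  interpret D: linear "frechet_derivative u (at p)"
    by (rule linear_frechet_derivative[OF homog_poly_differentiable[OF assms(1)]])
  let ?D = "frechet_derivative u (at p)"
  have "?D v = 0" if v: "v \<bullet> p = 0" for v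
  proof -
    have "?D v = ?D ((v \<bullet> e 1) *\<^sub>R e 1 + (v \<bullet> e 2) *\<^sub>R e 2 + (v \<bullet> e 3) *\<^sub>R e 3)"
      by (simp add: orthonormal_frame_expand[OF assms(2)])
    also have "\<dots> = (v \<bullet> e 1) * ?D (e 1) + (v \<bullet> e 2) * ?D (e 2) + (v \<bullet> e 3) * ?D (e 3)"
      by (simp only: D.add D.scale real_scaleR_def)
    finally have Dv: "?D v = \<dots>" .
    have D12: "(p \<bullet> e 3) * ?D (e 1) = (p \<bullet> e 1) * ?D (e 3)" "(p \<bullet> e 3) * ?D (e 2) = (p \<bullet> e 2) * ?D (e 3)"
      using assms(5,6) by (auto simp: angular_derivative_def)
    have "v \<bullet> p = v \<bullet> ((p \<bullet> e 1) *\<^sub>R e 1 + (p \<bullet> e 2) *\<^sub>R e 2 + (p \<bullet> e 3) *\<^sub>R e 3)"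
      by (simp add: orthonormal_frame_expand[OF assms(2)])
    also have "\<dots> = (v \<bullet> e 1) * (p \<bullet> e 1) + (v \<bullet> e 2) * (p \<bullet> e 2) + (v \<bullet> e 3) * (p \<bullet> e 3)"
      by (simp add: inner_add_right mult.commute)
    finally have vp: "(v \<bullet> e 1) * (p \<bullet> e 1) + (v \<bullet> e 2) * (p \<bullet> e 2) + (v \<bullet> e 3) * (p \<bullet> e 3) = 0"
      using v by simp
    have "(p \<bullet> e 3) * ?D v = (v \<bullet> e 1) * ((p \<bullet> e 3) * ?D (e 1)) + (v \<bullet> e 2) * ((p \<bullet> e 3) * ?D (e 2))
        + (v \<bullet> e 3) * (p \<bullet> e 3) * ?D (e 3)"
      unfolding Dv by (simp only: distrib_left mult.assoc mult.left_commute)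
    also have "\<dots> = ((v \<bullet> e 1) * (p \<bullet> e 1) + (v \<bullet> e 2) * (p \<bullet> e 2) + (v \<bullet> e 3) * (p \<bullet> e 3)) * ?D (e 3)"
      unfolding D12 by (simp only: distrib_right mult.assoc)
    also have "\<dots> = 0" by (simp add: vp)
    finally show ?thesis using assms(4) by simp
  qed
  then show ?thesis using assms(3) by (simp add: real_sphere_critical_points_def)
qed

text \<open>\<open>bezout_bound\<close> speaks of finite sets of zeros only. Applied to all finite
  subsets, its uniform bound also gives finiteness.\<close>

lemma common_zeros_coprime:
  fixes F G :: "real poly poly"
  assumes "coprime F G"
  defines "Z \<equiv> {(x, y). eval2 F x y = 0 \<and> eval2 G x y = 0}"
  shows "finite Z \<and> card Z \<le> total_degree F * total_degree G"
proof (cases "F = 0 \<or> G = 0")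
  case True
  then have "F dvd 1 \<or> G dvd 1" using assms(1) by auto
  then have "Z = {}" using eval2_dvd[of F 1] eval2_dvd[of G 1] by (fastforce simp: Z_def)
  then show ?thesis by simp
next
  case False
  have "card W \<le> total_degree F * total_degree G" if "finite W" "W \<subseteq> Z" for W
    using False that assms(1) by (intro bezout_bound) (auto simp: Z_def)
  then show ?thesis using finite_if_finite_subsets_card_bdd[of Z "total_degree F * total_degree G"] by blast
qed

text \<open>\<open>F\<close> and \<open>G\<close> are parameters because \<open>ex_pull_back\<close>
  supplies them only existentially.\<close>

locale critical_chart =
  fixes n u e F G
  assumes harmonic: "harmonic_poly n u" and frame: "orthonormal_frame e"
    and F: "total_degree_le F n" "pulls_back_to (angular_derivative (e 2) (e 3) u) e F"
    and G: "total_degree_le G n" "pulls_back_to (angular_derivative (e 3) (e 1) u) e G"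
begin

definition "zeros = {(x, y). eval2 F x y = 0 \<and> eval2 G x y = 0}"

definition "sphere_point = (\<lambda>(s, t). frame_chart e s t /\<^sub>R norm (frame_chart e s t))"

lemma homog_poly_u: "homog_poly n u"
  using harmonic by (rule harmonic_polyD)

lemma homog_poly_angular: "homog_poly n (angular_derivative a b u)"
  using harmonic_poly_angular_derivative[OF harmonic] by (rule harmonic_polyD)

lemma norm_frame_chart: "norm (frame_chart e s t) > 0"
  using frame_chart_inner(3)[OF frame, of s t] by force

lemma sphere_point_critical: "z \<in> zeros \<Longrightarrow> sphere_point z \<in> real_sphere_critical_points u"
proof (cases z)
  case (Pair s t)
  assume z: "z \<in> zeros"
  let ?x = "frame_chart e s t"
  have "angular_derivative (e 2) (e 3) u ?x = 0" "angular_derivative (e 3) (e 1) u ?x = 0"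
    using z F G by (auto simp: zeros_def Pair pulls_back_to_def)
  then have "angular_derivative (e 2) (e 3) u (?x /\<^sub>R norm ?x) = 0" 
       "angular_derivative (e 3) (e 1) u (?x /\<^sub>R norm ?x) = 0"
    by (simp_all add: homog_poly_scaleR[OF homog_poly_angular])
  moreover have "norm (?x /\<^sub>R norm ?x) = 1" "(?x /\<^sub>R norm ?x) \<bullet> e 3 \<noteq> 0"
    using norm_frame_chart[of s t] by (simp_all add: frame_chart_inner[OF frame])
  ultimately show ?thesis
    unfolding Pair sphere_point_def using critical_if_angular_derivatives_vanish[OF homog_poly_u frame] by simp
qed

lemma inj_sphere_point: "inj sphere_point"
proof (rule injI, clarify)
  fix s t s' t' assume eq: "sphere_point (s, t) = sphere_point (s', t')"
  have *: "sphere_point (s, t) \<bullet> e i = (frame_chart e s t \<bullet> e i) / norm (frame_chart e s t)" for s t i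
    by (simp add: sphere_point_def divide_inverse mult.commute)
  have "(sphere_point (s, t) \<bullet> e 1) / (sphere_point (s, t) \<bullet> e 3) = s"
     "(sphere_point (s, t) \<bullet> e 2) / (sphere_point (s, t) \<bullet> e 3) = t" for s t
    using norm_frame_chart[of s t] by (simp_all add: * frame_chart_inner[OF frame])
  then show "s = s' \<and> t = t'" using eq by metis
qed

lemma critical_subset:
  "{p \<in> real_sphere_critical_points u. p \<bullet> e 3 \<noteq> 0} \<subseteq> sphere_point ` zeros \<union> (\<lambda>z. - sphere_point z) ` zeros"
proof clarify
  fix p assume p: "p \<in> real_sphere_critical_points u" "p \<bullet> e 3 \<noteq> 0"
    "p \<notin> (\<lambda>z. - sphere_point z) ` zeros"
  define s where "s = p \<bullet> e 1 / (p \<bullet> e 3)"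
  define t where "t = p \<bullet> e 2 / (p \<bullet> e 3)"
  define r where "r = p \<bullet> e 3"
  have px: "p = r *\<^sub>R frame_chart e s t"
    unfolding s_def t_def r_def by (rule eq_scaleR_frame_chart[OF frame p(2)])
  have "r \<noteq> 0" using p by (simp add: r_def)
  have "norm p = 1" using p(1) by (simp add: real_sphere_critical_points_def)
  then have nx: "norm (frame_chart e s t) = 1 / \<bar>r\<bar>" using \<open>r \<noteq> 0\<close>
    by (subst (asm) px) (simp add: field_simps)
  have ang: "angular_derivative a b u (frame_chart e s t) = 0" for a b
    using angular_derivative_critical[OF homog_poly_u p(1), of a b] \<open>r \<noteq> 0\<close>
    by (subst (asm) px) (simp add: homog_poly_scaleR[OF homog_poly_angular])
  have "eval2 F s t = 0" "eval2 G s t = 0"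
    using F(2) G(2) ang unfolding pulls_back_to_def by metis+
  then have z: "(s, t) \<in> zeros" by (simp add: zeros_def)
  have sp: "sphere_point (s, t) = \<bar>r\<bar> *\<^sub>R frame_chart e s t"
    by (simp add: sphere_point_def nx)
  show "p \<in> sphere_point ` zeros"
  proof (cases "r > 0")
    case True
    then have "p = sphere_point (s, t)" using px sp by simp
    then show ?thesis using z by blast
  next
    case False
    then have "p = - sphere_point (s, t)" using px sp by simp
    then show ?thesis using z p(3) by blast
  qed
qed

text \<open>The chart sees only the points off the great circle perpendicular to \<open>e 3\<close>.
  For the count the frame is chosen with no critical point on that circle; in the generic part the
  circle is treated separately.\<close>

lemma finite_critical_if_coprime:
  assumes "coprime F G"
  shows "finite {p \<in> real_sphere_critical_points u. p \<bullet> e 3 \<noteq> 0}"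
    and "card {p \<in> real_sphere_critical_points u. p \<bullet> e 3 \<noteq> 0} \<le> 2 * n\<^sup>2"
proof -
  let ?S = "sphere_point ` zeros \<union> (\<lambda>z. - sphere_point z) ` zeros"
  have fin: "finite zeros" and card: "card zeros \<le> total_degree F * total_degree G"
    using common_zeros_coprime[OF assms] by (auto simp: zeros_def)
  have finS: "finite ?S" using fin by simp
  show "finite {p \<in> real_sphere_critical_points u. p \<bullet> e 3 \<noteq> 0}"
    using critical_subset finS by (rule finite_subset)
  have "card {p \<in> real_sphere_critical_points u. p \<bullet> e 3 \<noteq> 0} \<le> card ?S"
    using critical_subset finS by (intro card_mono)
  also have "\<dots> \<le> card zeros + card zeros"
    by (rule order.trans[OF card_Un_le add_mono]) (auto intro: card_image_le fin)
  also have "\<dots> \<le> 2 * (n * n)"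
    using card mult_mono[OF total_degree_leI[OF F(1)] total_degree_leI[OF G(1)]] by simp
  finally show "card {p \<in> real_sphere_critical_points u. p \<bullet> e 3 \<noteq> 0} \<le> 2 * n\<^sup>2"
    by (simp add: power2_eq_square)
qed

lemma coprime_if_finite_critical:
  assumes "finite (real_sphere_critical_points u)"
  shows "coprime F G"
proof -
  have fin: "finite zeros"
    using sphere_point_critical inj_on_subset[OF inj_sphere_point] assms
    by (intro inj_on_finite[of sphere_point]) auto
  define w where "w = gcd F G"
  have wz: "{(x, y). eval2 w x y = 0} \<subseteq> zeros"
    using eval2_dvd[of w F] eval2_dvd[of w G] by (auto simp: zeros_def w_def)
  have "infinite (UNIV :: (real \<times> real) set)"
    by (simp add: finite_prod infinite_UNIV_char_0)
  \<comment> \<open>If both polynomials vanished, the whole plane would consist of common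
    zeros.\<close>
  then have nz: "F \<noteq> 0 \<or> G \<noteq> 0" using fin by (auto simp: zeros_def)
  have "(\<forall>x y. eval2 w x y \<ge> 0) \<or> (\<forall>x y. eval2 (- w) x y \<ge> 0)"
  proof (rule ccontr)
    assume "\<not> ?thesis"
    then obtain a b c d where "eval2 w a b > 0" "eval2 w c d < 0" by (auto simp: not_le)
    then have "infinite {(x, y). eval2 w x y = 0}" by (rule infinite_zeros_if_sign_change)
    then show False using wz fin finite_subset by blast
  qed
  moreover have "w dvd F" "w dvd G" by (simp_all add: w_def)
  ultimately have "\<exists>w'. w' dvd F \<and> w' dvd G \<and> w dvd w' \<and> (\<forall>x y. eval2 w' x y \<ge> 0)"
  proof (elim disjE)
    assume "\<forall>x y. eval2 (- w) x y \<ge> 0"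
    with \<open>w dvd F\<close> \<open>w dvd G\<close> show ?thesis by (intro exI[of _ "- w"]) simp
  qed (auto intro!: exI[of _ w])
  then obtain w' where w': "w' dvd F" "w' dvd G" "w dvd w'" "\<And>x y. eval2 w' x y \<ge> 0"
    by blast
  \<comment> \<open>The semidefinite factor is excluded by a nonzero multiple of it, which may be
    either of \<open>F\<close> and \<open>G\<close>.\<close>
  have "total_degree w' = 0"
  proof (cases "F = 0")
    case False
    obtain q where "F = w' * q" using w'(1) by (elim dvdE)
    then show ?thesis
      using harmonic_poly_semidefinite_factor[OF frame harmonic_poly_angular_derivative[OF harmonic] F(2,1) False] w'(4)
      by blast
  next
    case True
    then have "G \<noteq> 0" using nz by blast
    obtain q where "G = w' * q" using w'(2) by (elim dvdE)
    then show ?thesis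
      using harmonic_poly_semidefinite_factor[OF frame harmonic_poly_angular_derivative[OF harmonic] G(2,1) \<open>G \<noteq> 0\<close>] w'(4)
      by blast
  qed
  then obtain c where c: "w' = [:[:c:]:]" using total_degree_eq_0_imp by blast
  have "c \<noteq> 0" using c w'(1,2) nz by auto
  then have "is_unit w'" by (simp add: c is_unit_pCons_iff is_unit_const_poly_iff)
  then have "is_unit w" using w'(3) dvd_trans by blast
  then show ?thesis by (simp add: w_def coprime_iff_gcd_eq_1)
qed

end

lemma ex_critical_chart:
  assumes "harmonic_poly n u" "orthonormal_frame e"
  shows "\<exists>F G. critical_chart n u e F G"
proof -
  have h: "homog_poly n (angular_derivative a b u)" for a b
    using harmonic_poly_angular_derivative[OF assms(1)] by (rule harmonic_polyD)
  obtain F where F: "total_degree_le F n" "pulls_back_to (angular_derivative (e 2) (e 3) u) e F"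
    using ex_pull_back[OF h, where e = e] by blast
  obtain G where G: "total_degree_le G n" "pulls_back_to (angular_derivative (e 3) (e 1) u) e G"
    using ex_pull_back[OF h, where e = e] by blast
  have "critical_chart n u e F G" using assms F G by unfold_locales
  then show ?thesis by blast
qed

lemma card_real_sphere_critical_points_le:
  assumes "harmonic_poly n u" "finite (real_sphere_critical_points u)"
  shows "card (real_sphere_critical_points u) \<le> 2 * n\<^sup>2"
proof -
  have "0 \<notin> real_sphere_critical_points u" by (simp add: real_sphere_critical_points_def)
  from ex_orthonormal_frame_avoiding[OF assms(2) this]
  obtain e where e: "orthonormal_frame e" "\<And>p. p \<in> real_sphere_critical_points u \<Longrightarrow> p \<bullet> e 3 \<noteq> 0"
    by blast
  obtain F G where "critical_chart n u e F G" using ex_critical_chart[OF assms(1) e(1)] by blast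
  then interpret critical_chart n u e F G .
  have "{p \<in> real_sphere_critical_points u. p \<bullet> e 3 \<noteq> 0} = real_sphere_critical_points u"
    using e(2) by blast
  then show ?thesis using finite_critical_if_coprime(2)[OF coprime_if_finite_critical[OF assms(2)]] by simp
qed

section \<open>Binary forms without common zeros\<close>

text \<open>Interpolation at the nodes 0, ..., n expresses coefficients and derivatives by finitely
  many point values, the quantities that pointwise convergence controls.\<close>

definition lagrange_basis :: "nat \<Rightarrow> nat \<Rightarrow> real poly" where
  "lagrange_basis n m = (\<Prod>j\<in>{..n} - {m}. smult (1 / (real m - real j)) [:- real j, 1:])"

lemma poly_lagrange_basis:
  assumes "i \<le> n" "m \<le> n"
  shows "poly (lagrange_basis n m) (real i) = (if i = m then 1 else 0)"
proof (cases "i = m")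
  case True
  then show ?thesis
    by (auto simp: lagrange_basis_def poly_prod diff_divide_distrib[symmetric] intro!: prod.neutral)
next
  case False
  then have "\<exists>j\<in>{..n} - {m}. poly (smult (1 / (real m - real j)) [:- real j, 1:]) (real i) = 0"
    using assms by (intro bexI[of _ i]) auto
  then show ?thesis using False by (simp add: lagrange_basis_def poly_prod)
qed

lemma degree_lagrange_basis: "m \<le> n \<Longrightarrow> degree (lagrange_basis n m) \<le> n"
proof -
  assume "m \<le> n"
  have "degree (lagrange_basis n m) \<le> (\<Sum>j\<in>{..n} - {m}. degree (smult (1 / (real m - real j)) [:- real j, 1:]))"
    unfolding lagrange_basis_def by (rule degree_prod_sum_le[unfolded comp_def]) simp
  also have "\<dots> \<le> (\<Sum>j\<in>{..n} - {m}. 1)"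
    by (intro sum_mono order.trans[OF degree_smult_le]) simp
  also have "\<dots> = n" using \<open>m \<le> n\<close> by simp
  finally show ?thesis .
qed

lemma coeff_lagrange_interpolation:
  assumes "degree p \<le> n"
  shows "coeff p k = (\<Sum>m\<le>n. coeff (lagrange_basis n m) k * poly p (real m))"
proof -
  have "p = (\<Sum>m\<le>n. smult (poly p (real m)) (lagrange_basis n m))" (is "_ = ?q")
  proof (rule poly_eqI_degree)
    fix x assume "x \<in> real ` {..n}"
    then obtain i where i: "x = real i" "i \<le> n" by auto
    have "poly ?q x = (\<Sum>m\<le>n. poly p (real m) * (if i = m then 1 else 0))"
      using i by (simp add: poly_sum poly_lagrange_basis)
    also have "\<dots> = poly p x" using i by (simp add: if_distrib[of "\<lambda>t. _ * t"] cong: if_cong)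
    finally show "poly p x = poly ?q x" by simp
  next
    show "card (real ` {..n}) > degree p" using assms by (simp add: card_image)
    have "degree ?q \<le> n"
      by (intro degree_sum_le order.trans[OF degree_smult_le] degree_lagrange_basis) auto
    then show "card (real ` {..n}) > degree ?q" by (simp add: card_image)
  qed
  then have "coeff p k = coeff ?q k" by simp
  then show ?thesis by (simp add: coeff_sum mult.commute)
qed

text \<open>The degree \<open>n\<close> is formal: the top coefficients may vanish, and
  \<open>a n = 0\<close> means a zero at infinity. The coefficients are real, but the zeros that
  matter are complex.\<close>

definition binary_form :: "nat \<Rightarrow> (nat \<Rightarrow> real) \<Rightarrow> complex \<Rightarrow> complex \<Rightarrow> complex" where
  "binary_form n a y z = (\<Sum>k\<le>n. of_real (a k) * y ^ k * z ^ (n - k))"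

text \<open>For \<open>n \<ge> 1\<close> this is the nonvanishing of the resultant of the two
  forms.\<close>

definition no_common_zero :: "nat \<Rightarrow> (nat \<Rightarrow> real) \<Rightarrow> (nat \<Rightarrow> real) \<Rightarrow> bool" where
  "no_common_zero n a b \<longleftrightarrow>
     (\<forall>y z. (y, z) \<noteq> (0, 0) \<longrightarrow> binary_form n a y z \<noteq> 0 \<or> binary_form n b y z \<noteq> 0)"

lemma binary_form_scale: "binary_form n a (c * y) (c * z) = c ^ n * binary_form n a y z"
  unfolding binary_form_def sum_distrib_left
proof (intro sum.cong refl)
  fix k assume "k \<in> {..n}"
  then have "c ^ n = c ^ k * c ^ (n - k)" by (simp add: power_add[symmetric])
  then show "complex_of_real (a k) * (c * y) ^ k * (c * z) ^ (n - k) =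
     c ^ n * (complex_of_real (a k) * y ^ k * z ^ (n - k))"
    by (simp add: power_mult_distrib)
qed

lemma binary_form_infinity: "binary_form n a y 0 = of_real (a n) * y ^ n"
proof -
  have "binary_form n a y 0 = (\<Sum>k\<in>{n}. of_real (a k) * y ^ k * 0 ^ (n - k))"
    unfolding binary_form_def by (rule sum.mono_neutral_right) auto
  then show ?thesis by simp
qed

lemma binary_form_add_scale:
  "binary_form n (\<lambda>k. a k + t * b k) y z = binary_form n a y z + of_real t * binary_form n b y z"
  unfolding binary_form_def sum_distrib_left sum.distrib[symmetric]
  by (intro sum.cong) (auto simp: algebra_simps)

lemma no_common_zero_iff:
  "no_common_zero n a b \<longleftrightarrow> (a n \<noteq> 0 \<or> b n \<noteq> 0) \<and> (\<forall>y. binary_form n a y 1 \<noteq> 0 \<or> binary_form n b y 1 \<noteq> 0)"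
proof (intro iffI conjI allI)
  assume *: "no_common_zero n a b"
  show "a n \<noteq> 0 \<or> b n \<noteq> 0"
    using *[unfolded no_common_zero_def, rule_format, of 1 0] by (simp add: binary_form_infinity)
  show "binary_form n a y 1 \<noteq> 0 \<or> binary_form n b y 1 \<noteq> 0" for y
    using *[unfolded no_common_zero_def, rule_format, of y 1] by simp
next
  assume *: "(a n \<noteq> 0 \<or> b n \<noteq> 0) \<and> (\<forall>y. binary_form n a y 1 \<noteq> 0 \<or> binary_form n b y 1 \<noteq> 0)"
  show "no_common_zero n a b"
    unfolding no_common_zero_def
  proof (intro allI impI)
    fix y z :: complex assume yz: "(y, z) \<noteq> (0, 0)"
    show "binary_form n a y z \<noteq> 0 \<or> binary_form n b y z \<noteq> 0"
    proof (cases "z = 0")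
      case True
      then show ?thesis using * yz by (simp add: binary_form_infinity)
    next
      case False
      have "binary_form n c y z = z ^ n * binary_form n c (y / z) 1" for c
        using binary_form_scale[of n c z "y / z" 1] False by simp
      then show ?thesis using * False by simp
    qed
  qed
qed

lemma norm_binary_form_diff:
  assumes "norm y \<le> 1" "norm z \<le> 1"
  shows "norm (binary_form n a y z - binary_form n b y z) \<le> (\<Sum>k\<le>n. \<bar>a k - b k\<bar>)"
proof -
  have "binary_form n a y z - binary_form n b y z = (\<Sum>k\<le>n. of_real (a k - b k) * y ^ k * z ^ (n - k))"
    unfolding binary_form_def sum_subtractf[symmetric] by (intro sum.cong) (auto simp: algebra_simps)
  also have "norm \<dots> \<le> (\<Sum>k\<le>n. norm (of_real (a k - b k) * y ^ k * z ^ (n - k)))"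
    by (rule norm_sum)
  also have "\<dots> \<le> (\<Sum>k\<le>n. \<bar>a k - b k\<bar>)"
  proof (intro sum_mono)
    fix k
    have "norm y ^ k * norm z ^ (n - k) \<le> 1 * 1"
      using assms by (intro mult_mono power_le_one) auto
    then have "\<bar>a k - b k\<bar> * (norm y ^ k * norm z ^ (n - k)) \<le> \<bar>a k - b k\<bar> * 1"
      by (intro mult_left_mono) auto
    then show "norm (of_real (a k - b k) * y ^ k * z ^ (n - k)) \<le> \<bar>a k - b k\<bar>"
      by (simp only: norm_mult norm_power norm_of_real mult.assoc mult_1_right)
  qed
  finally show ?thesis .
qed

text \<open>On the compact unit sphere of pairs the sum of the two absolute values has a positive
  minimum. A smaller change of the coefficients cannot bring it to 0, and homogeneity reduces all
  nonzero pairs to unit ones.\<close>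

lemma no_common_zero_open:
  assumes "no_common_zero n a b"
  shows "\<exists>m>0. \<forall>a' b'. (\<Sum>k\<le>n. \<bar>a k - a' k\<bar>) + (\<Sum>k\<le>n. \<bar>b k - b' k\<bar>) < m \<longrightarrow> no_common_zero n a' b'"
proof -
  define K :: "(complex \<times> complex) set" where "K = sphere 0 1"
  define f where "f = (\<lambda>p. norm (binary_form n a (fst p) (snd p)) + norm (binary_form n b (fst p) (snd p)))"
  have "compact K" by (simp add: K_def)
  moreover have "(1, 0) \<in> K" by (simp add: K_def norm_Pair)
  then have "K \<noteq> {}" by blast
  moreover have "continuous_on K f"
    unfolding f_def binary_form_def by (intro continuous_intros)
  ultimately obtain p where p: "p \<in> K" "\<And>q. q \<in> K \<Longrightarrow> f p \<le> f q"
    using continuous_attains_inf[of K f] by blast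
  have "p \<noteq> 0" using p by (auto simp: K_def)
  then have "(fst p, snd p) \<noteq> (0, 0)" by (simp add: prod_eq_iff)
  then have "binary_form n a (fst p) (snd p) \<noteq> 0 \<or> binary_form n b (fst p) (snd p) \<noteq> 0"
    using assms unfolding no_common_zero_def by blast
  then have "f p > 0" unfolding f_def by (auto intro: add_pos_nonneg add_nonneg_pos)
  moreover have "no_common_zero n a' b'"
    if close: "(\<Sum>k\<le>n. \<bar>a k - a' k\<bar>) + (\<Sum>k\<le>n. \<bar>b k - b' k\<bar>) < f p" for a' b'
    unfolding no_common_zero_def
  proof (intro allI impI)
    fix y z :: complex assume yz: "(y, z) \<noteq> (0, 0)"
    define r where "r = norm (y, z)"
    have r: "r > 0" using yz unfolding r_def by (simp add: zero_prod_def)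
    define y' where "y' = of_real (inverse r) * y"
    define z' where "z' = of_real (inverse r) * z"
    have "(y', z') = inverse r *\<^sub>R (y, z)" by (simp add: y'_def z'_def scaleR_conv_of_real)
    then have "norm (y', z') = \<bar>inverse r\<bar> * r" by (simp only: norm_scaleR r_def)
    then have n1: "norm (y', z') = 1" using r by simp
    then have le: "norm y' \<le> 1" "norm z' \<le> 1" using norm_fst_le[of y' z'] norm_snd_le[of z' y'] by auto
    have "f p \<le> f (y', z')" using p n1 by (simp add: K_def)
    moreover have "norm (binary_form n a y' z') \<le> norm (binary_form n a' y' z') + (\<Sum>k\<le>n. \<bar>a k - a' k\<bar>)"
      using norm_binary_form_diff[OF le, of n a a'] norm_triangle_ineq2[of "binary_form n a y' z'" "binary_form n a' y' z'"]
      by linarith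
    moreover have "norm (binary_form n b y' z') \<le> norm (binary_form n b' y' z') + (\<Sum>k\<le>n. \<bar>b k - b' k\<bar>)"
      using norm_binary_form_diff[OF le, of n b b'] norm_triangle_ineq2[of "binary_form n b y' z'" "binary_form n b' y' z'"]
      by linarith
    ultimately have "norm (binary_form n a' y' z') + norm (binary_form n b' y' z') > 0"
      using close unfolding f_def by simp
    then have "binary_form n a' y' z' \<noteq> 0 \<or> binary_form n b' y' z' \<noteq> 0" by auto
    then show "binary_form n a' y z \<noteq> 0 \<or> binary_form n b' y z \<noteq> 0"
      unfolding y'_def z'_def binary_form_scale by auto
  qed
  ultimately show ?thesis by blast
qed

definition complex_poly_of :: "nat \<Rightarrow> (nat \<Rightarrow> real) \<Rightarrow> complex poly" where
  "complex_poly_of n a = (\<Sum>k\<le>n. monom (of_real (a k)) k)"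

lemma poly_complex_poly_of: "poly (complex_poly_of n a) y = binary_form n a y 1"
  by (simp add: complex_poly_of_def binary_form_def poly_sum poly_monom)

lemma coeff_complex_poly_of: "k \<le> n \<Longrightarrow> coeff (complex_poly_of n a) k = of_real (a k)"
  by (simp add: complex_poly_of_def coeff_sum)

lemma degree_complex_poly_of: "degree (complex_poly_of n a) \<le> n"
  unfolding complex_poly_of_def by (intro degree_sum_le order.trans[OF degree_monom_le]) auto

lemma coprime_complex_polyI:
  fixes p q :: "complex poly"
  assumes "p \<noteq> 0" "\<And>y. poly p y \<noteq> 0 \<or> poly q y \<noteq> 0"
  shows "coprime p q"
proof -
  have "degree (gcd p q) = 0"
  proof (rule ccontr)
    assume "degree (gcd p q) \<noteq> 0"
    then have "\<not> constant (poly (gcd p q))" by (simp add: constant_degree)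
    then obtain y where y: "poly (gcd p q) y = 0"
      using fundamental_theorem_of_algebra by blast
    have "poly p y = 0" "poly q y = 0"
      using y dvd_trans[OF _ gcd_dvd1] dvd_trans[OF _ gcd_dvd2] by (simp_all add: poly_eq_0_iff_dvd)
    then show False using assms(2) by blast
  qed
  moreover have "gcd p q \<noteq> 0" using assms(1) by simp
  ultimately have "is_unit (gcd p q)" using is_unit_iff_degree by blast
  then show ?thesis by (simp add: coprime_iff_gcd_eq_1)
qed

text \<open>The point at infinity and each finite \<open>y\<close> exclude at most one parameter
  \<open>t\<close>, so the issue is that only finitely many parameters arise from all
  \<open>y\<close> together.\<close>

lemma finite_degenerate_parameters:
  assumes nc: "no_common_zero n a0 b0" and lead: "a0 n \<noteq> 0"
  shows "finite {t. \<not> no_common_zero n (\<lambda>k. a k + t * a0 k) (\<lambda>k. b k + t * b0 k)}"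
proof -
  define p where "p = complex_poly_of n a"
  define q where "q = complex_poly_of n b"
  define p0 where "p0 = complex_poly_of n a0"
  define q0 where "q0 = complex_poly_of n b0"
  define R where "R = (\<lambda>y. {t. poly p y + complex_of_real t * poly p0 y = 0 \<and> poly q y + of_real t * poly q0 y = 0})"
  have c0: "coeff p0 n \<noteq> 0" using lead by (simp add: p0_def coeff_complex_poly_of)
  then have "p0 \<noteq> 0" by auto
  have deg: "degree p0 = n"
    using le_degree[OF c0] degree_complex_poly_of[of n a0] by (simp add: p0_def)
  have root0: "poly p0 y \<noteq> 0 \<or> poly q0 y \<noteq> 0" for y
    using nc by (simp add: p0_def q0_def poly_complex_poly_of no_common_zero_iff)
  have single: "finite {t. c + complex_of_real t * d = 0}" if "d \<noteq> 0" for c d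
  proof (rule finite_subset)
    show "{t. c + complex_of_real t * d = 0} \<subseteq> {Re (- c / d)}"
    proof clarify
      fix t assume "c + complex_of_real t * d = 0"
      then have "complex_of_real t = - c / d" using that by (simp add: field_simps add_eq_0_iff2)
      then show "t = Re (- c / d)" by (metis Re_complex_of_real)
    qed
  qed simp
  have finR: "finite (R y)" for y
  proof (cases "poly p0 y = 0")
    case False
    show ?thesis by (rule finite_subset[OF _ single[OF False, of "poly p y"]]) (auto simp: R_def)
  next
    case True
    then have nz: "poly q0 y \<noteq> 0" using root0 by blast
    show ?thesis by (rule finite_subset[OF _ single[OF nz, of "poly q y"]]) (auto simp: R_def)
  qed
  have "{t. \<not> no_common_zero n (\<lambda>k. a k + t * a0 k) (\<lambda>k. b k + t * b0 k)}
      \<subseteq> {t. complex_of_real (a n) + of_real t * of_real (a0 n) = 0} \<union> (\<Union>y. R y)"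
  proof
    fix t assume "t \<in> {t. \<not> no_common_zero n (\<lambda>k. a k + t * a0 k) (\<lambda>k. b k + t * b0 k)}"
    then consider "a n + t * a0 n = 0" | y where "binary_form n a y 1 + of_real t * binary_form n a0 y 1 = 0"
      "binary_form n b y 1 + of_real t * binary_form n b0 y 1 = 0"
      unfolding no_common_zero_iff binary_form_add_scale by auto
    then show "t \<in> {t. complex_of_real (a n) + of_real t * of_real (a0 n) = 0} \<union> (\<Union>y. R y)"
    proof cases
      case 1
      then have "complex_of_real (a n + t * a0 n) = 0" by simp
      then show ?thesis by simp
    next
      case 2
      then show ?thesis by (auto simp: R_def p_def q_def p0_def q0_def poly_complex_poly_of)
    qed
  qed
  moreover have "finite {t. complex_of_real (a n) + of_real t * of_real (a0 n) = 0}"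
    using lead by (intro single) simp
  moreover have "finite (\<Union>y. R y)"
  proof (cases "p * q0 = q * p0")
    case False
    \<comment> \<open>A common root of \<open>p + t p0\<close> and \<open>q + t q0\<close> is a root of \<open>p q0 - q p0\<close>, and determines \<open>t\<close>.\<close>
    then have "p * q0 - q * p0 \<noteq> 0" by simp
    then have "finite {y. poly (p * q0 - q * p0) y = 0}" by (rule poly_roots_finite)
    moreover have "R y = {}" if "poly (p * q0 - q * p0) y \<noteq> 0" for y
    proof -
      have "poly p y * poly q0 y = poly q y * poly p0 y" if "t \<in> R y" for t
      proof -
        have "poly p y = - of_real t * poly p0 y" "poly q y = - of_real t * poly q0 y"
          using that by (simp_all add: R_def add_eq_0_iff2)
        then show ?thesis by simp
      qed
      then show ?thesis using that by auto
    qed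
    then have "(\<Union>y. R y) = (\<Union>y\<in>{y. poly (p * q0 - q * p0) y = 0}. R y)" by blast
    ultimately show ?thesis using finR by simp
  next
    case True
    \<comment> \<open>Here the two pairs are proportional: coprimality gives a factor
      \<open>r\<close> with \<open>p = p0 * r\<close>, and \<open>r\<close> is constant because
      \<open>p0\<close> has the full degree \<open>n\<close>. Then only the parameter
      \<open>- c\<close> can be bad, whatever \<open>y\<close> is.\<close>
    have "coprime p0 q0" using \<open>p0 \<noteq> 0\<close> root0 by (rule coprime_complex_polyI)
    moreover have "p0 dvd p * q0" using True by simp
    ultimately have "p0 dvd p" by (simp add: coprime_dvd_mult_left_iff)
    then obtain r where r: "p = p0 * r" by (elim dvdE)
    have "degree r = 0"
    proof (cases "r = 0")
      case False
      then have "degree p = n + degree r" using \<open>p0 \<noteq> 0\<close> deg by (simp add: r degree_mult_eq)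
      then show ?thesis using degree_complex_poly_of[of n a] by (simp add: p_def)
    qed simp
    then obtain c where c: "r = [:c:]" by (elim degree_eq_zeroE)
    have "p0 * (q0 * r - q) = 0" using True by (simp add: r algebra_simps)
    then have qr: "q = q0 * r" using \<open>p0 \<noteq> 0\<close> by simp
    have "R y \<subseteq> {t. c + of_real t * 1 = 0}" for y
    proof
      fix t assume "t \<in> R y"
      then have "(c + of_real t) * poly p0 y = 0" "(c + of_real t) * poly q0 y = 0"
        by (simp_all add: R_def r qr c algebra_simps)
      then show "t \<in> {t. c + of_real t * 1 = 0}" using root0[of y] by auto
    qed
    then have "(\<Union>y. R y) \<subseteq> {t. c + of_real t * 1 = 0}" by blast
    then show ?thesis using single[of 1 c] finite_subset by fastforce
  qed
  ultimately show ?thesis using finite_subset by blast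
qed

lemma poly_restrict: "poly (map_poly (\<lambda>c. poly c 0) P) y = eval2 P 0 y"
  by (induction P) (simp_all add: map_poly_pCons eval2_def)

lemma map_poly_restrict_mult:
  fixes P Q :: "real poly poly"
  shows "map_poly (\<lambda>c. poly c 0) (P * Q) = map_poly (\<lambda>c. poly c 0) P * map_poly (\<lambda>c. poly c 0) Q"
proof -
  have "poly (map_poly (\<lambda>c. poly c 0) (P * Q)) = poly (map_poly (\<lambda>c. poly c 0) P * map_poly (\<lambda>c. poly c 0) Q)"
    by (rule ext) (simp add: poly_restrict)
  then show ?thesis by (simp only: poly_eq_poly_eq_iff)
qed

lemma poly_of_real_mult:
  fixes p q :: "real poly"
  shows "poly (map_poly complex_of_real (p * q)) y = poly (map_poly of_real p) y * poly (map_poly of_real q) y"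
proof (induction p)
  case (pCons c p)
  have "poly (map_poly complex_of_real (smult c q)) y = of_real c * poly (map_poly of_real q) y" for c
    by (induction q) (simp_all add: map_poly_pCons algebra_simps)
  moreover have "poly (map_poly complex_of_real (r + s)) y = poly (map_poly of_real r) y + poly (map_poly of_real s) y"
    for r s :: "real poly"
    by (induction r s rule: poly_induct2) (simp_all add: map_poly_pCons algebra_simps)
  ultimately show ?case using pCons by (simp add: map_poly_pCons algebra_simps)
qed simp

lemma poly_of_real_eq_binary_form:
  assumes "degree p \<le> n"
  shows "poly (map_poly complex_of_real p) y = binary_form n (coeff p) y 1"
proof -
  have "poly (map_poly complex_of_real p) y = (\<Sum>k\<le>degree p. of_real (coeff p k) * y ^ k)"
    by (simp add: poly_altdef coeff_map_poly degree_map_poly)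
  also have "\<dots> = (\<Sum>k\<le>n. of_real (coeff p k) * y ^ k)"
    using assms by (intro sum.mono_neutral_left) (auto simp: coeff_eq_0)
  finally show ?thesis by (simp add: binary_form_def)
qed

lemma total_degree_le_coeff_degree: 
  assumes "total_degree_le P n"
  shows "degree P \<le> n" "degree (coeff P n) = 0"
proof -
  show "degree P \<le> n"
  proof (rule degree_le, intro allI impI)
    fix j assume "n < j"
    then show "coeff P j = 0" using assms unfolding total_degree_le_def
      by (intro poly_eqI) fastforce
  qed
  have "degree (coeff P n) \<le> 0"
    by (rule degree_le) (use assms in \<open>fastforce simp: total_degree_le_def\<close>)
  then show "degree (coeff P n) = 0" by simp
qed

text \<open>
  A common factor \<open>w\<close> divides a polynomial whose coefficient of \<open>Y ^ n\<close> is a nonzero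
  constant. So its own leading coefficient is constant, hence its degree in \<open>Y\<close> survives the
  restriction to \<open>X = 0\<close>, where \<open>w\<close> has no root.
\<close>
lemma coprime_if_no_common_zero:
  fixes F G :: "real poly poly"
  assumes "total_degree_le F n" "total_degree_le G n"
    and nc: "no_common_zero n (\<lambda>k. coeff (coeff F k) 0) (\<lambda>k. coeff (coeff G k) 0)"
  shows "coprime F G"
proof -
  define w where "w = gcd F G"
  let ?r = "map_poly (\<lambda>c. poly c (0::real))"
  have lead: "degree (lead_coeff w) = 0 \<and> lead_coeff w \<noteq> 0"
    if P: "w dvd P" "total_degree_le P n" "coeff (coeff P n) 0 \<noteq> 0" for P
  proof -
    have "coeff P n \<noteq> 0" using P(3) by auto
    then have d: "degree P = n"  using total_degree_le_coeff_degree(1)[OF P(2)] le_degree[of P n] by linarith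
    obtain q where q: "P = w * q" using P(1) by (elim dvdE)
    have "P \<noteq> 0" using \<open>coeff P n \<noteq> 0\<close> by auto
    then have nz: "lead_coeff w \<noteq> 0" "lead_coeff q \<noteq> 0" using q by auto
    have "degree (lead_coeff P) = 0" using total_degree_le_coeff_degree(2)[OF P(2)] d by simp
    then have "degree (lead_coeff w * lead_coeff q) = 0" by (simp only: q lead_coeff_mult)
    then show ?thesis using nz by (simp add: degree_mult_eq)
  qed
  have "coeff (coeff F n) 0 \<noteq> 0 \<or> coeff (coeff G n) 0 \<noteq> 0"
    using nc by (simp add: no_common_zero_iff)
  then have lw: "degree (lead_coeff w) = 0" "lead_coeff w \<noteq> 0"
    using lead[of F] lead[of G] assms(1,2) by (auto simp: w_def)
  then obtain c where c: "lead_coeff w = [:c:]" by (elim degree_eq_zeroE)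
  have "c \<noteq> 0" using lw c by auto
  have dw: "degree (?r w) = degree w"
  proof (rule antisym)
    show "degree (?r w) \<le> degree w" by (intro degree_le) (simp add: coeff_map_poly coeff_eq_0)
    show "degree w \<le> degree (?r w)"
      using \<open>c \<noteq> 0\<close> c by (intro le_degree) (simp add: coeff_map_poly)
  qed
  have "degree w = 0"
  proof (rule ccontr)
    assume "degree w \<noteq> 0"
    then have "degree (map_poly complex_of_real (?r w)) \<noteq> 0" by (simp add: degree_map_poly dw)
    then have "\<not> constant (poly (map_poly complex_of_real (?r w)))" by (simp add: constant_degree)
    then obtain y where y: "poly (map_poly complex_of_real (?r w)) y = 0"
      using fundamental_theorem_of_algebra by blast
    have "binary_form n (\<lambda>k. coeff (coeff P k) 0) y 1 = 0" if P: "w dvd P" "total_degree_le P n" for P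
    proof -
      obtain q where q: "P = w * q" using P(1) by (elim dvdE)
      have "degree (?r P) \<le> n"
        using total_degree_le_coeff_degree(1)[OF P(2)] by (intro degree_le) (simp add: coeff_map_poly coeff_eq_0)
      then have "binary_form n (coeff (?r P)) y 1 = poly (map_poly complex_of_real (?r P)) y"
        by (simp add: poly_of_real_eq_binary_form)
      also have "\<dots> = 0" by (simp add: q map_poly_restrict_mult poly_of_real_mult y)
      also have "coeff (?r P) = (\<lambda>k. coeff (coeff P k) 0)"
        by (simp add: fun_eq_iff coeff_map_poly poly_0_coeff_0)
      finally show ?thesis .
    qed
    then show False using nc assms(1,2) by (auto simp: no_common_zero_iff w_def)
  qed
  then have "w = [:[:c:]:]" using c by (metis degree_0_id degree_eq_zeroE lead_coeff_pCons(2) coeff_pCons_0 pCons_0_0)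
  then have "is_unit w" using \<open>c \<noteq> 0\<close> by (simp add: is_unit_pCons_iff is_unit_const_poly_iff)
  then show ?thesis by (simp add: w_def coprime_iff_gcd_eq_1)
qed

section \<open>Genericity\<close>

lemma homog_poly_line:
  "homog_poly d p \<Longrightarrow> \<exists>P. degree P \<le> d \<and> (\<forall>t. p (x + t *\<^sub>R b) = poly P t)"
proof (induction rule: homog_poly.induct)
  case (const c)
  show ?case by (intro exI[of _ "[:c:]"]) simp
next
  case (add d p q)
  then obtain P Q where "degree P \<le> d" "\<forall>t. p (x + t *\<^sub>R b) = poly P t"
     "degree Q \<le> d" "\<forall>t. q (x + t *\<^sub>R b) = poly Q t" by blast
  then show ?case by (intro exI[of _ "P + Q"]) (simp add: degree_add_le)
next
  case (coord d p i)
  then obtain P where P: "degree P \<le> d" "\<forall>t. p (x + t *\<^sub>R b) = poly P t" by blast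
  have "degree ([:x $ i, b $ i:] * P) \<le> degree [:x $ i, b $ i:] + degree P" by (rule degree_mult_le)
  also have "\<dots> \<le> Suc d" using P by simp
  finally show ?case using P by (intro exI[of _ "[:x $ i, b $ i:] * P"]) (simp add: algebra_simps)
qed

lemma frechet_derivative_line:
  assumes "homog_poly d p" "\<And>t. p (x + t *\<^sub>R b) = poly P t"
  shows "frechet_derivative p (at x) b = coeff P 1"
proof -
  have "((\<lambda>t. x + t *\<^sub>R b) has_derivative (\<lambda>h. h *\<^sub>R b)) (at 0)"
    by (auto intro!: derivative_eq_intros)
  moreover have "(p has_derivative frechet_derivative p (at x)) (at (x + 0 *\<^sub>R b))"
    using homog_poly_differentiable[OF assms(1)] by (simp add: frechet_derivative_works[symmetric])
  ultimately have "((\<lambda>t. p (x + t *\<^sub>R b)) has_derivative (\<lambda>h. frechet_derivative p (at x) (h *\<^sub>R b))) (at 0)"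
    by (rule has_derivative_compose)
  then have "(poly P has_derivative (\<lambda>h. frechet_derivative p (at x) (h *\<^sub>R b))) (at 0)"
    by (simp only: assms(2))
  moreover have "(poly P has_derivative (\<lambda>h. poly (pderiv P) 0 * h)) (at 0)"
    using poly_DERIV[of P 0] by (simp add: has_field_derivative_def)
  ultimately have "(\<lambda>h. frechet_derivative p (at x) (h *\<^sub>R b)) = (\<lambda>h. poly (pderiv P) 0 * h)"
    by (rule has_derivative_unique)
  from fun_cong[OF this, of 1] show ?thesis by (simp add: poly_0_coeff_0 coeff_pderiv)
qed

text \<open>An exact differentiation rule with n + 1 points for polynomials of degree at most n.
  Being defined for arbitrary functions, it is linear without any hypothesis and depends on finitely
  many values.\<close>

definition line_derivative :: "nat \<Rightarrow> (real ^ 3 \<Rightarrow> real) \<Rightarrow> real ^ 3 \<Rightarrow> real ^ 3 \<Rightarrow> real" where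
  "line_derivative n w x b = (\<Sum>l\<le>n. coeff (lagrange_basis n l) 1 * w (x + real l *\<^sub>R b))"

lemma frechet_derivative_eq_line_derivative:
  assumes "homog_poly n p"
  shows "frechet_derivative p (at x) b = line_derivative n p x b"
proof -
  obtain P where P: "degree P \<le> n" "\<And>t. p (x + t *\<^sub>R b) = poly P t"
    using homog_poly_line[OF assms] by blast
  show ?thesis
    unfolding line_derivative_def P(2) frechet_derivative_line[OF assms P(2)]
    by (rule coeff_lagrange_interpolation[OF P(1)])
qed

abbreviation std_axis :: "3 \<Rightarrow> real ^ 3" where
  "std_axis i \<equiv> axis i 1"

text \<open>
  The coefficients of the restrictions to \<open>X = 0\<close> of the two polynomials of the standard chart,
  as finite combinations of point values. So they depend continuously on the function in the
  topology of pointwise convergence.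
\<close>
definition restricted_coeff1 :: "nat \<Rightarrow> (real ^ 3 \<Rightarrow> real) \<Rightarrow> nat \<Rightarrow> real" where
  "restricted_coeff1 n w k = (\<Sum>m\<le>n. coeff (lagrange_basis n m) k *
     (real m * line_derivative n w (frame_chart std_axis 0 (real m)) (std_axis 3)
      - line_derivative n w (frame_chart std_axis 0 (real m)) (std_axis 2)))"

definition restricted_coeff2 :: "nat \<Rightarrow> (real ^ 3 \<Rightarrow> real) \<Rightarrow> nat \<Rightarrow> real" where
  "restricted_coeff2 n w k = (\<Sum>m\<le>n. coeff (lagrange_basis n m) k *
     line_derivative n w (frame_chart std_axis 0 (real m)) (std_axis 1))"

lemma line_derivative_add_scale:
  "line_derivative n (\<lambda>x. v x + t * w x) x b = line_derivative n v x b + t * line_derivative n w x b"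
  by (simp add: line_derivative_def distrib_left sum.distrib sum_distrib_left mult.left_commute)

lemma restricted_coeff_add_scale:
  "restricted_coeff1 n (\<lambda>x. v x + t * w x) k = restricted_coeff1 n v k + t * restricted_coeff1 n w k"
  "restricted_coeff2 n (\<lambda>x. v x + t * w x) k = restricted_coeff2 n v k + t * restricted_coeff2 n w k"
  unfolding restricted_coeff1_def restricted_coeff2_def line_derivative_add_scale
    sum_distrib_left sum.distrib[symmetric]
  by (intro sum.cong refl; simp add: algebra_simps)+

lemma continuous_on_restricted_coeff:
  "continuous_on S (\<lambda>u :: real ^ 3 \<Rightarrow> complex. restricted_coeff1 n (\<lambda>x. Re (u x)) k)"
  "continuous_on S (\<lambda>u :: real ^ 3 \<Rightarrow> complex. restricted_coeff2 n (\<lambda>x. Re (u x)) k)"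
proof -
  have "continuous_on S (\<lambda>u :: real ^ 3 \<Rightarrow> complex. u x)" for x
    by (rule continuous_on_subset[OF continuous_on_product_coordinates]) simp
  then show "continuous_on S (\<lambda>u :: real ^ 3 \<Rightarrow> complex. restricted_coeff1 n (\<lambda>x. Re (u x)) k)"
    "continuous_on S (\<lambda>u :: real ^ 3 \<Rightarrow> complex. restricted_coeff2 n (\<lambda>x. Re (u x)) k)"
    unfolding restricted_coeff1_def restricted_coeff2_def line_derivative_def
    by (intro continuous_intros; simp)+
qed

lemma poly_eq_if_eq_off_0:
  fixes p q :: "real poly"
  assumes "\<And>z. z \<noteq> 0 \<Longrightarrow> poly p z = poly q z"
  shows "p = q"
proof (rule ccontr)
  assume "p \<noteq> q"
  then have "finite {z. poly (p - q) z = 0}" by (intro poly_roots_finite) simp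
  then have "finite (UNIV - {0 :: real})" by (rule finite_subset[rotated]) (use assms in auto)
  then show False by (simp add: infinite_UNIV_char_0)
qed

lemma complex_poly_eq_if_eq_on_reals:
  fixes p q :: "complex poly"
  assumes "\<And>y. poly p (of_real y) = poly q (of_real y)"
  shows "p = q"
proof (rule ccontr)
  assume "p \<noteq> q"
  then have "finite {z. poly (p - q) z = 0}" by (intro poly_roots_finite) simp
  then have "finite (range complex_of_real)" by (rule finite_subset[rotated]) (use assms in auto)
  then show False by (simp add: finite_image_iff inj_on_def infinite_UNIV_char_0)
qed

section \<open>The standard chart, its line x1 = 0, and the equator\<close>

locale standard_chart = critical_chart n u std_axis F G for n u F G
begin

lemma degree_restrict: "total_degree_le P n \<Longrightarrow> degree (map_poly (\<lambda>c. poly c (0::real)) P) \<le> n"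
  using total_degree_le_coeff_degree(1)[of P n]
  by (intro degree_le) (simp add: coeff_map_poly coeff_eq_0)

lemma coeff_restrict: "coeff (map_poly (\<lambda>c. poly c (0::real)) P) k = coeff (coeff P k) 0"
  by (simp add: coeff_map_poly poly_0_coeff_0)

lemma angular_on_line:
  "angular_derivative (std_axis 2) (std_axis 3) u (frame_chart std_axis 0 t) =
     t * frechet_derivative u (at (frame_chart std_axis 0 t)) (std_axis 3)
       - frechet_derivative u (at (frame_chart std_axis 0 t)) (std_axis 2)"
  "angular_derivative (std_axis 3) (std_axis 1) u (frame_chart std_axis 0 t) =
     frechet_derivative u (at (frame_chart std_axis 0 t)) (std_axis 1)"
  by (simp_all add: angular_derivative_def frame_chart_inner[OF frame])

lemma restricted_coeff_eq:
  "restricted_coeff1 n u k = coeff (coeff F k) 0" "restricted_coeff2 n u k = coeff (coeff G k) 0"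
proof -
  have "coeff (coeff P k) 0 = (\<Sum>m\<le>n. coeff (lagrange_basis n m) k * eval2 P 0 (real m))"
    if "total_degree_le P n" for P
    using coeff_lagrange_interpolation[OF degree_restrict[OF that], of k]
    by (simp add: coeff_restrict poly_restrict)
  from this[OF F(1)] this[OF G(1)]
  show "restricted_coeff1 n u k = coeff (coeff F k) 0" "restricted_coeff2 n u k = coeff (coeff G k) 0"
    using F(2) G(2)
    by (simp_all add: restricted_coeff1_def restricted_coeff2_def pulls_back_to_def[symmetric]
       pulls_back_to_def[THEN iffD1, rule_format, symmetric] angular_on_line
       frechet_derivative_eq_line_derivative[OF homog_poly_u])
qed

lemma binary_form_restricted_coeff:
  "binary_form n (restricted_coeff1 n u) (of_real y) 1 =
     of_real (angular_derivative (std_axis 2) (std_axis 3) u (frame_chart std_axis 0 y))"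
  "binary_form n (restricted_coeff2 n u) (of_real y) 1 =
     of_real (angular_derivative (std_axis 3) (std_axis 1) u (frame_chart std_axis 0 y))"
proof -
  have "binary_form n (\<lambda>k. coeff (coeff P k) 0) (of_real y) 1 = of_real (eval2 P 0 y)"
    if "total_degree_le P n" for P
  proof -
    have "poly (map_poly complex_of_real p) (of_real y) = of_real (poly p y)" for p
      by (induction p) (simp_all add: map_poly_pCons)
    moreover have "coeff (map_poly (\<lambda>c. poly c 0) P) = (\<lambda>k. coeff (coeff P k) 0)"
      by (rule ext) (rule coeff_restrict)
    ultimately show ?thesis
      using poly_of_real_eq_binary_form[OF degree_restrict[OF that], of "of_real y"]
      by (simp only: poly_restrict)
  qed
  from this[OF F(1)] this[OF G(1)] show
   "binary_form n (restricted_coeff1 n u) (of_real y) 1 =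
     of_real (angular_derivative (std_axis 2) (std_axis 3) u (frame_chart std_axis 0 y))"
   "binary_form n (restricted_coeff2 n u) (of_real y) 1 =
     of_real (angular_derivative (std_axis 3) (std_axis 1) u (frame_chart std_axis 0 y))"
    using F(2) G(2) by (simp_all add: restricted_coeff_eq[abs_def] pulls_back_to_def)
qed

text \<open>The point at infinity of the line x1 = 0 in the chart x3 = 1 is
  \<open>std_axis 2\<close>, and the top coefficient of a restricted polynomial is the value there
  of the form it comes from.\<close>

lemma restricted_coeff_top:
  "restricted_coeff1 n u n = angular_derivative (std_axis 2) (std_axis 3) u (std_axis 2)"
  "restricted_coeff2 n u n = angular_derivative (std_axis 3) (std_axis 1) u (std_axis 2)"
proof -
  have "coeff (coeff P n) 0 = h (std_axis 2)"
    if P: "total_degree_le P n" "pulls_back_to h std_axis P" and h: "homog_poly n h" for P h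
  proof -
    let ?p = "map_poly (\<lambda>c. poly c 0) P"
    obtain R where R: "degree R \<le> n" "\<And>z. h (std_axis 2 + z *\<^sub>R std_axis 3) = poly R z"
      using homog_poly_line[OF h] by blast
    \<comment> \<open>The restriction with its coefficients in reverse order, which is the same form
      in the opposite affine coordinate.\<close>
    define Q where "Q = (\<Sum>k\<le>n. monom (coeff ?p k) (n - k))"
    have "R = Q"
    proof (rule poly_eq_if_eq_off_0)
      fix z :: real assume z: "z \<noteq> 0"
      have "std_axis 2 + z *\<^sub>R std_axis 3 = z *\<^sub>R frame_chart std_axis 0 (1 / z)"
        using z by (simp add: frame_chart_def scaleR_add_right)
      then have "poly R z = z ^ n * h (frame_chart std_axis 0 (1 / z))"
        by (simp only: R(2)[symmetric] homog_poly_scaleR[OF h])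
      also have "\<dots> = z ^ n * poly ?p (1 / z)"
        using P(2) by (simp add: pulls_back_to_def poly_restrict)
      also have "poly ?p (1 / z) = (\<Sum>k\<le>n. coeff ?p k * (1 / z) ^ k)"
        unfolding poly_altdef[of ?p] using degree_restrict[OF P(1)]
        by (intro sum.mono_neutral_left) (auto simp: coeff_eq_0)
      also have "z ^ n * \<dots> = (\<Sum>k\<le>n. coeff ?p k * z ^ (n - k))"
        unfolding sum_distrib_left
      proof (intro sum.cong refl)
        fix k assume "k \<in> {..n}"
        then have "z ^ n = z ^ (n - k) * z ^ k" by (simp add: power_add[symmetric])
        then show "z ^ n * (coeff ?p k * (1 / z) ^ k) = coeff ?p k * z ^ (n - k)"
          using z by (simp add: power_divide)
      qed
      also have "\<dots> = poly Q z" by (simp add: Q_def poly_sum poly_monom)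
      finally show "poly R z = poly Q z" .
    qed
    then have "h (std_axis 2) = poly Q 0" using R(2)[of 0] by simp
    also have "\<dots> = (\<Sum>k\<in>{n}. coeff ?p k * 0 ^ (n - k))"
      unfolding Q_def poly_sum poly_monom by (rule sum.mono_neutral_right) auto
    finally show ?thesis by (simp add: coeff_restrict)
  qed
  then show "restricted_coeff1 n u n = angular_derivative (std_axis 2) (std_axis 3) u (std_axis 2)"
    "restricted_coeff2 n u n = angular_derivative (std_axis 3) (std_axis 1) u (std_axis 2)"
    using F G homog_poly_angular by (simp_all add: restricted_coeff_eq)
qed

text \<open>A form in two variables that is not identically zero has finitely many zero lines, and
  each meets the great circle x3 = 0 in two points.\<close>

lemma finite_critical_on_equator:
  assumes "h (std_axis 2) \<noteq> 0" "homog_poly n h" "\<And>p. p \<in> real_sphere_critical_points u \<Longrightarrow> h p = 0"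
  shows "finite {p \<in> real_sphere_critical_points u. p $ 3 = 0}"
proof -
  obtain P where P: "\<And>t. h (std_axis 1 + t *\<^sub>R std_axis 2) = poly P t"
    using homog_poly_line[OF assms(2)] by blast
  obtain Q where Q: "\<And>t. h (std_axis 2 + t *\<^sub>R std_axis 1) = poly Q t"
    using homog_poly_line[OF assms(2)] by blast
  \<comment> \<open>Otherwise \<open>h\<close> vanishes on the whole plane x3 = 0 away from the line
    of \<open>std_axis 2\<close>, and then, as a polynomial along \<open>Q\<close>, at
    \<open>std_axis 2\<close> too.\<close>
  have "P \<noteq> 0"
  proof
    assume "P = 0"
    have "Q = 0"
    proof (rule poly_eq_if_eq_off_0)
      fix z :: real assume "z \<noteq> 0"
      then have "std_axis 2 + z *\<^sub>R std_axis 1 = z *\<^sub>R (std_axis 1 + (1 / z) *\<^sub>R std_axis 2)"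
        by (simp add: scaleR_add_right)
      then have "poly Q z = z ^ n * poly P (1 / z)"
        by (simp only: Q[symmetric] P[symmetric] homog_poly_scaleR[OF assms(2)])
      then show "poly Q z = poly 0 z" by (simp add: \<open>P = 0\<close>)
    qed
    then show False using Q[of 0] assms(1) by simp
  qed
  let ?q = "\<lambda>t. std_axis 1 + t *\<^sub>R std_axis 2"
  let ?S = "(\<lambda>t. sgn (?q t)) ` {t. poly P t = 0} \<union> (\<lambda>t. - sgn (?q t)) ` {t. poly P t = 0} \<union> {std_axis 2, - std_axis 2}"
  have "{p \<in> real_sphere_critical_points u. p $ 3 = 0} \<subseteq> ?S"
  proof
    fix p :: "real ^ 3"
    assume "p \<in> {p \<in> real_sphere_critical_points u. p $ 3 = 0}"
    then have p: "p \<in> real_sphere_critical_points u" "p $ 3 = 0" by simp_all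
    have np: "norm p = 1" using p(1) by (simp add: real_sphere_critical_points_def)
    show "p \<in> ?S"
    proof (cases "p $ 1 = 0")
      case True
      then have p2: "p = (p $ 2) *\<^sub>R std_axis 2"
        using p(2) by (simp add: vec_eq_iff forall_3 axis_def)
      have "\<bar>p $ 2\<bar> = 1" using arg_cong[OF p2, of norm] np by simp
      then have "p $ 2 = 1 \<or> p $ 2 = - 1" by linarith
      then have "p = std_axis 2 \<or> p = - std_axis 2"
      proof (elim disjE)
        assume "p $ 2 = 1"
        then show ?thesis using p2 by simp
      next
        assume "p $ 2 = - 1"
        then show ?thesis using p2 by simp
      qed
      then show ?thesis by blast
    next
      case False
      define t where "t = p $ 2 / p $ 1"
      have pq: "p = (p $ 1) *\<^sub>R ?q t"
        using p(2) False by (simp add: vec_eq_iff forall_3 axis_def t_def)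
      have "h p = (p $ 1) ^ n * poly P t"
        using arg_cong[OF pq, of h] by (simp only: homog_poly_scaleR[OF assms(2)] P)
      then have root: "poly P t = 0" using assms(3)[OF p(1)] False by simp
      have "p = sgn p" using np by (simp add: sgn_div_norm)
      also have "\<dots> = sgn ((p $ 1) *\<^sub>R ?q t)" by (rule arg_cong[OF pq])
      also have "\<dots> = sgn (p $ 1) *\<^sub>R sgn (?q t)" by (rule sgn_scaleR)
      finally have "p = sgn (p $ 1) *\<^sub>R sgn (?q t)" .
      then have "p = sgn (?q t) \<or> p = - sgn (?q t)" using False by (auto simp: sgn_real_def split: if_splits)
      then show ?thesis using root by blast
    qed
  qed
  moreover have "finite ?S" using poly_roots_finite[OF \<open>P \<noteq> 0\<close>] by simp
  ultimately show ?thesis by (rule finite_subset)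
qed

text \<open>The hypothesis is used twice: it makes \<open>F\<close> and \<open>G\<close> coprime,
  which settles x3 different from 0, and at infinity it provides an angular derivative nonzero at
  \<open>std_axis 2\<close>, which settles the equator.\<close>

lemma finite_critical_if_no_common_zero:
  assumes "no_common_zero n (restricted_coeff1 n u) (restricted_coeff2 n u)"
  shows "finite (real_sphere_critical_points u)"
proof -
  have "coprime F G"
    using assms F(1) G(1) by (intro coprime_if_no_common_zero) (auto simp: restricted_coeff_eq[abs_def])
  then have "finite {p \<in> real_sphere_critical_points u. p \<bullet> std_axis 3 \<noteq> 0}"
    by (rule finite_critical_if_coprime)
  moreover have "finite {p \<in> real_sphere_critical_points u. p $ 3 = 0}"
  proof -
    have "restricted_coeff1 n u n \<noteq> 0 \<or> restricted_coeff2 n u n \<noteq> 0"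
      using assms by (simp add: no_common_zero_iff)
    then obtain a b where "angular_derivative a b u (std_axis 2) \<noteq> 0"
      unfolding restricted_coeff_top by blast
    then show ?thesis
      using homog_poly_angular angular_derivative_critical[OF homog_poly_u] by (rule finite_critical_on_equator)
  qed
  ultimately have "finite ({p \<in> real_sphere_critical_points u. p \<bullet> std_axis 3 \<noteq> 0} \<union>
      {p \<in> real_sphere_critical_points u. p $ 3 = 0})" by simp
  then show ?thesis by (rule finite_subset[rotated]) (auto simp: inner_axis)
qed

end

lemma ex_standard_chart: "harmonic_poly n u \<Longrightarrow> \<exists>F G. standard_chart n u F G"
  using ex_critical_chart[OF _ orthonormal_frame_axis] by (simp add: standard_chart_def)

section \<open>The perturbing harmonic polynomial\<close>

definition yz_power :: "complex \<Rightarrow> nat \<Rightarrow> real ^ 3 \<Rightarrow> real" where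
  "yz_power c k x = Re (c * (of_real (x $ 2) + \<i> * of_real (x $ 3)) ^ k)"

lemma homog_poly_yz_power: "homog_poly k (yz_power c k)"
proof (induction k arbitrary: c)
  case 0
  have "yz_power c 0 = (\<lambda>x. Re c)" by (simp add: yz_power_def fun_eq_iff)
  then show ?case by (simp add: homog_poly.const)
next
  case (Suc k)
  have "yz_power c (Suc k) = (\<lambda>x. x $ 2 * yz_power c k x + x $ 3 * yz_power (\<i> * c) k x)"
    by (simp add: yz_power_def fun_eq_iff algebra_simps)
  then show ?case using Suc by (simp add: homog_poly.add homog_poly.coord)
qed

text \<open>The free factor \<open>c\<close> closes the family under partial derivatives and covers
  imaginary parts by \<open>c = - \<i>\<close>. For \<open>k = 0\<close> the new factor is 0, so the
  truncated exponent does no harm.\<close>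

lemma pderiv3_yz_power:
  "pderiv3 i (yz_power c k) = yz_power (c * of_nat k * (if i = 1 then 0 else if i = 2 then 1 else \<i>)) (k - 1)"
proof
  fix x :: "real ^ 3"
  let ?z = "\<lambda>x :: real ^ 3. complex_of_real (x $ 2) + \<i> * of_real (x $ 3)"
  have comp: "((\<lambda>x. x $ j) has_derivative (\<lambda>h. h $ j)) (at x)" for j
    by (rule bounded_linear_imp_has_derivative) (rule bounded_linear_vec_nth)
  have "(?z has_derivative ?z) (at x)"
    by (intro has_derivative_add has_derivative_mult_right has_derivative_of_real comp)
  from has_derivative_power[OF this, of k]
  have "((\<lambda>x. c * ?z x ^ k) has_derivative (\<lambda>h. c * (of_nat k * ?z h * ?z x ^ (k - 1)))) (at x)"
    by (rule has_derivative_mult_right)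
  then have "((\<lambda>x. Re (c * ?z x ^ k)) has_derivative (\<lambda>h. Re (c * (of_nat k * ?z h * ?z x ^ (k - 1))))) (at x)"
    by (rule has_derivative_Re)
  then have "pderiv3 i (\<lambda>x. Re (c * ?z x ^ k)) x = Re (c * (of_nat k * ?z (axis i 1) * ?z x ^ (k - 1)))"
    by (rule pderiv3_eqI)
  moreover have "?z (axis i 1) = (if i = 1 then 0 else if i = 2 then 1 else \<i>)"
    using exhaust_3[of i] by (auto simp: axis_def)
  ultimately show "pderiv3 i (yz_power c k) x =
      yz_power (c * of_nat k * (if i = 1 then 0 else if i = 2 then 1 else \<i>)) (k - 1) x"
    by (simp add: yz_power_def[abs_def] mult.assoc)
qed

lemma harmonic_poly_yz_power: "harmonic_poly k (yz_power c k)"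
proof -
  have "yz_power (\<i> * (\<i> * d)) m x = - yz_power d m x" for d m x
    by (simp add: yz_power_def mult.assoc[symmetric])
  moreover have "yz_power 0 m x = 0" for m x by (simp add: yz_power_def)
  ultimately show ?thesis
    by (simp add: harmonic_poly_def homog_poly_yz_power pderiv3_yz_power sum_3 mult_ac)
qed

text \<open>On x1 = 0 the first angular derivative sees only the first summand and the second one
  only the second, so the two restrictions can be prescribed independently.\<close>

definition generic_harmonic :: "nat \<Rightarrow> real ^ 3 \<Rightarrow> real" where
  "generic_harmonic m x = yz_power (- \<i>) (Suc m) x + x $ 1 * yz_power 1 m x"

lemma harmonic_poly_generic_harmonic: "harmonic_poly (Suc m) (generic_harmonic m)"
proof -
  have "pderiv3 1 (yz_power 1 m) x = 0" for x
    by (simp add: pderiv3_yz_power yz_power_def)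
  moreover have "(\<Sum>i\<in>UNIV. pderiv3 i (pderiv3 i (yz_power 1 m)) x) = 0" for x
    using harmonic_poly_yz_power[of m 1] by (simp add: harmonic_poly_def)
  ultimately have "harmonic_poly (Suc m) (\<lambda>x. x $ 1 * yz_power 1 m x)"
    by (simp add: harmonic_poly_def pderiv3_pderiv3_coord[OF homog_poly_yz_power] homog_poly.coord
        homog_poly_yz_power sum.distrib sum_distrib_left[symmetric])
  then show ?thesis unfolding generic_harmonic_def by (intro harmonic_poly_add harmonic_poly_yz_power)
qed

lemma generic_harmonic_nondegenerate:
  fixes m :: nat
  defines "w \<equiv> generic_harmonic m" and "n \<equiv> Suc m"
  shows "no_common_zero n (restricted_coeff1 n w) (restricted_coeff2 n w)" "restricted_coeff1 n w n \<noteq> 0"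
proof -
  obtain F G where "standard_chart n w F G"
    unfolding n_def w_def using ex_standard_chart harmonic_poly_generic_harmonic by blast
  then interpret standard_chart n w F G .
  have pd: "frechet_derivative w (at x) (std_axis i) = pderiv3 i (yz_power (- \<i>) n) x +
       ((if i = 1 then yz_power 1 m x else 0) + x $ 1 * pderiv3 i (yz_power 1 m) x)" for i x
  proof -
    have "w = (\<lambda>x. yz_power (- \<i>) n x + x $ 1 * yz_power 1 m x)"
      by (simp add: w_def n_def generic_harmonic_def fun_eq_iff)
    then have "pderiv3 i w x = pderiv3 i (\<lambda>x. yz_power (- \<i>) n x + x $ 1 * yz_power 1 m x) x" by simp
    then show ?thesis
      unfolding pderiv3_add[OF homog_poly_yz_power homog_poly.coord[OF homog_poly_yz_power]]
        pderiv3_coord[OF homog_poly_yz_power] by (simp add: pderiv3_def)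
  qed
  have chart: "frame_chart std_axis 0 y $ 1 = 0" "frame_chart std_axis 0 y $ 2 = y" "frame_chart std_axis 0 y $ 3 = 1" for y
    by (simp_all add: frame_chart_def axis_def)
  have a1: "angular_derivative (std_axis 2) (std_axis 3) w (frame_chart std_axis 0 y) = n * Re ((of_real y + \<i>) ^ n)" for y
    unfolding angular_on_line pd
    by (simp add: chart pderiv3_yz_power yz_power_def n_def algebra_simps)
  have a2: "angular_derivative (std_axis 3) (std_axis 1) w (frame_chart std_axis 0 y) = Re ((of_real y + \<i>) ^ m)" for y
    unfolding angular_on_line pd
    by (simp add: chart pderiv3_yz_power yz_power_def n_def)
  have "angular_derivative (std_axis 2) (std_axis 3) w (std_axis 2) = n"
    unfolding angular_derivative_def pd
    by (simp add: inner_axis_axis pderiv3_yz_power yz_power_def n_def) (simp add: axis_def)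
  then show top: "restricted_coeff1 n w n \<noteq> 0" unfolding restricted_coeff_top by (simp add: n_def)
  \<comment> \<open>Replacing the conjugate of y + i by y - i, valid for real y, gives polynomials
    in y. Equality on the reals then extends to complex y, where the zeros have to be
    examined.\<close>
  have Re2: "complex_of_real (Re ((of_real y + \<i>) ^ k)) = ((of_real y + \<i>) ^ k + (of_real y - \<i>) ^ k) / 2" for y k
  proof -
    have "(of_real y - \<i>) ^ k = cnj ((of_real y + \<i>) ^ k)" by simp
    then show ?thesis by (simp only: complex_add_cnj) simp
  qed
  have form: "binary_form n a y 1 = poly P y"
    if "\<And>y. binary_form n a (of_real y) 1 = poly P (of_real y)" for a P and y :: complex
  proof -
    have "complex_poly_of n a = P"
      by (rule complex_poly_eq_if_eq_on_reals) (simp add: poly_complex_poly_of that)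
    then show ?thesis by (simp add: poly_complex_poly_of[symmetric])
  qed
  have ev: "poly [:\<i>, 1:] y = y + \<i>" "poly [:- \<i>, 1:] y = y - \<i>" for y by simp_all
  have f1: "binary_form n (restricted_coeff1 n w) y 1 = of_nat n / 2 * ((y + \<i>) ^ n + (y - \<i>) ^ n)" for y
    by (subst form[where P = "smult (of_nat n / 2) ([:\<i>, 1:] ^ n + [:- \<i>, 1:] ^ n)"])
       (simp_all only: binary_form_restricted_coeff(1) a1 of_real_mult of_real_of_nat_eq Re2 poly_smult poly_add poly_power ev
         times_divide_eq_left times_divide_eq_right)
  have f2: "binary_form n (restricted_coeff2 n w) y 1 = 1 / 2 * ((y + \<i>) ^ m + (y - \<i>) ^ m)" for y
    by (subst form[where P = "smult (1 / 2) ([:\<i>, 1:] ^ m + [:- \<i>, 1:] ^ m)"])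
       (simp_all only: binary_form_restricted_coeff(2) a2 Re2 poly_smult poly_add poly_power ev
         times_divide_eq_left mult_1_left)
  \<comment> \<open>Substituting the second equation into the first leaves 2 i (y + i)^m = 0, so y +
    i and y - i would both vanish.\<close>
  have "False" if z: "(y + \<i>) ^ n + (y - \<i>) ^ n = 0" "(y + \<i>) ^ m + (y - \<i>) ^ m = 0" for y
  proof -
    have b: "(y - \<i>) ^ m = - ((y + \<i>) ^ m)" using z(2) by (simp add: add_eq_0_iff)
    have "0 = (y + \<i>) * (y + \<i>) ^ m + (y - \<i>) * (y - \<i>) ^ m" using z(1) by (simp add: n_def)
    also have "\<dots> = 2 * \<i> * (y + \<i>) ^ m" unfolding b by (simp add: algebra_simps)
    finally have "(y + \<i>) ^ m = 0" by simp
    moreover from this have "(y - \<i>) ^ m = 0" using b by simp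
    ultimately have z0: "y + \<i> = 0" "y - \<i> = 0" by simp_all
    have "2 * \<i> = (y + \<i>) - (y - \<i>)" by simp
    also have "\<dots> = 0" unfolding z0 by simp
    finally show False by simp
  qed
  moreover have "complex_of_nat n \<noteq> 0" unfolding n_def by (rule of_nat_neq_0)
  ultimately show "no_common_zero n (restricted_coeff1 n w) (restricted_coeff2 n w)"
    unfolding no_common_zero_iff f1 f2 using top by auto
qed

section \<open>Transfer to complex-valued harmonic polynomials\<close>

lemma finite_homogeneous_exponents: "finite {(i, j, k). i + j + k = (n :: nat)}"
  by (rule finite_subset[of _ "{..n} \<times> {..n} \<times> {..n}"]) auto

lemma homogeneous_polynomial_of_real:
  "homog_poly n v \<Longrightarrow> homogeneous_polynomial n (\<lambda>x. of_real (v x))"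
proof (induction rule: homog_poly_monomial_induct)
  case (monomial c e)
  let ?S = "{(i, j, k). i + j + k = n}"
  let ?e = "(e 1, e 2, e 3)"
  let ?d = "\<lambda>i j k. if (i, j, k) = ?e then complex_of_real c else 0"
  show ?case
    unfolding homogeneous_polynomial_def
  proof (intro exI[of _ ?d] allI)
    fix x :: "real ^ 3"
    have "?e \<in> ?S" using monomial by (simp add: sum_3)
    have "(\<Sum>(i, j, k)\<in>?S. ?d i j k * of_real (x $ 1 ^ i * x $ 2 ^ j * x $ 3 ^ k))
       = (\<Sum>(i, j, k)\<in>{?e}. ?d i j k * of_real (x $ 1 ^ i * x $ 2 ^ j * x $ 3 ^ k))"
    proof (rule sum.mono_neutral_right)
      show "\<forall>s\<in>?S - {?e}. (case s of (i, j, k) \<Rightarrow> ?d i j k * of_real (x $ 1 ^ i * x $ 2 ^ j * x $ 3 ^ k)) = 0"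
        by (auto simp only: case_prod_conv if_False mult_zero_left split: if_splits)
    qed (use \<open>?e \<in> ?S\<close> finite_homogeneous_exponents in \<open>simp_all only: finite.intros insert_subset empty_subsetI\<close>)
    also have "\<dots> = of_real (c * monomial3 e x)" by (simp add: monomial3_def prod_UNIV_3)
    finally show "of_real (c * monomial3 e x) =
       (\<Sum>(i, j, k)\<in>?S. ?d i j k * of_real (x $ 1 ^ i * x $ 2 ^ j * x $ 3 ^ k))" by simp
  qed
next
  case (add p q)
  then obtain c d where
    "\<And>x. complex_of_real (p x) = (\<Sum>(i, j, k) \<in> {(i, j, k). i + j + k = n}. c i j k * of_real (x $ 1 ^ i * x $ 2 ^ j * x $ 3 ^ k))"
    "\<And>x. complex_of_real (q x) = (\<Sum>(i, j, k) \<in> {(i, j, k). i + j + k = n}. d i j k * of_real (x $ 1 ^ i * x $ 2 ^ j * x $ 3 ^ k))"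
    unfolding homogeneous_polynomial_def by blast
  then show ?case
    unfolding homogeneous_polynomial_def
    by (intro exI[of _ "\<lambda>i j k. c i j k + d i j k"]) (simp add: case_prod_unfold distrib_right sum.distrib)
qed

text \<open>The monomials are real valued, so it suffices to take the real parts of the
  coefficients.\<close>

lemma homog_poly_Re:
  assumes "homogeneous_polynomial n u"
  shows "homog_poly n (\<lambda>x. Re (u x))"
proof -
  let ?S = "{(i, j, k). i + j + k = n}"
  obtain c where c: "\<And>x. u x = (\<Sum>(i, j, k)\<in>?S. c i j k * of_real (x $ 1 ^ i * x $ 2 ^ j * x $ 3 ^ k))"
    using assms unfolding homogeneous_polynomial_def by blast
  have "Re (u x) = (\<Sum>s\<in>?S. Re (c (fst s) (fst (snd s)) (snd (snd s))) *
      (x $ 1 ^ fst s * (x $ 2 ^ fst (snd s) * x $ 3 ^ snd (snd s))))" for x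
    unfolding c case_prod_unfold Re_sum
    by (intro sum.cong refl) (simp only: Re_complex_of_real complex.sel times_complex.sel of_real_def[symmetric] Im_complex_of_real mult_zero_right diff_zero mult.assoc)
  moreover have "homog_poly n (\<lambda>x. \<Sum>s\<in>?S. Re (c (fst s) (fst (snd s)) (snd (snd s))) *
      (x $ 1 ^ fst s * (x $ 2 ^ fst (snd s) * x $ 3 ^ snd (snd s))))"
  proof (intro homog_poly_sum homog_poly_scale)
    fix s assume "s \<in> ?S"
    then have "1 * fst s + (1 * fst (snd s) + 1 * snd (snd s)) = n" by auto
    moreover have "homog_poly (1 * fst s + (1 * fst (snd s) + 1 * snd (snd s)))
       (\<lambda>x. x $ 1 ^ fst s * (x $ 2 ^ fst (snd s) * x $ 3 ^ snd (snd s)))"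
      by (intro homog_poly_mult homog_poly_power homog_poly_component)
    ultimately show "homog_poly n (\<lambda>x. x $ 1 ^ fst s * (x $ 2 ^ fst (snd s) * x $ 3 ^ snd (snd s)))" by simp
  qed
  ultimately show ?thesis by simp
qed

lemma frechet_derivative_of_real:
  assumes "homog_poly n v"
  shows "frechet_derivative (\<lambda>x. complex_of_real (v x)) (at x) h = of_real (frechet_derivative v (at x) h)"
proof -
  have "(v has_derivative frechet_derivative v (at x)) (at x)"
    using homog_poly_differentiable[OF assms] by (simp add: frechet_derivative_works[symmetric])
  then have "((\<lambda>x. complex_of_real (v x)) has_derivative (\<lambda>h. of_real (frechet_derivative v (at x) h))) (at x)"
    by (rule has_derivative_of_real)
  from fun_cong[OF frechet_derivative_at[OF this], of h] show ?thesis by simp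
qed

lemma partial_derivative_of_real:
  "homog_poly n v \<Longrightarrow> partial_derivative i (\<lambda>x. of_real (v x)) = (\<lambda>x. of_real (pderiv3 i v x))"
  by (rule ext) (simp add: partial_derivative_def frechet_derivative_of_real pderiv3_def)

lemma laplacian_of_real:
  "homog_poly n v \<Longrightarrow> laplacian (\<lambda>x. of_real (v x)) x = of_real (\<Sum>i\<in>UNIV. pderiv3 i (pderiv3 i v) x)"
  by (simp add: laplacian_def partial_derivative_of_real[of n v] partial_derivative_of_real[OF homog_poly_pderiv3[of n v]])

lemma of_real_in_real_harmonic_polynomials:
  "harmonic_poly n v \<Longrightarrow> (\<lambda>x. of_real (v x)) \<in> real_harmonic_polynomials n"
  unfolding real_harmonic_polynomials_def harmonic_polynomials_def harmonic_poly_def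
  by (auto simp: homogeneous_polynomial_of_real laplacian_of_real)

lemma real_harmonic_polynomials_Re:
  assumes "u \<in> real_harmonic_polynomials n"
  shows "harmonic_poly n (\<lambda>x. Re (u x))" "u = (\<lambda>x. of_real (Re (u x)))"
proof -
  show u: "u = (\<lambda>x. of_real (Re (u x)))"
    using assms by (auto simp: real_harmonic_polynomials_def fun_eq_iff)
  have h: "homog_poly n (\<lambda>x. Re (u x))"
    using assms by (intro homog_poly_Re) (simp add: real_harmonic_polynomials_def harmonic_polynomials_def)
  have "laplacian u x = 0" for x
    using assms by (simp add: real_harmonic_polynomials_def harmonic_polynomials_def)
  then have "complex_of_real (\<Sum>i\<in>UNIV. pderiv3 i (pderiv3 i (\<lambda>x. Re (u x))) x) = 0" for x
    using laplacian_of_real[OF h, of x] by (simp only: u[symmetric])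
  then show "harmonic_poly n (\<lambda>x. Re (u x))"
    using h unfolding harmonic_poly_def of_real_eq_0_iff by blast
qed

lemma sphere_critical_points_of_real:
  assumes "homog_poly n v"
  shows "sphere_critical_points (\<lambda>x. of_real (v x)) = real_sphere_critical_points v"
  by (auto simp: sphere_critical_points_def real_sphere_critical_points_def sphere_tangent_space_def
      frechet_derivative_of_real[OF assms])

lemma card_sphere_critical_points_le:
  assumes "u \<in> real_harmonic_polynomials n" "finite (sphere_critical_points u)"
  shows "card (sphere_critical_points u) \<le> 2 * n\<^sup>2"
proof -
  note h = real_harmonic_polynomials_Re[OF assms(1)]
  have "sphere_critical_points u = real_sphere_critical_points (\<lambda>x. Re (u x))"
    using sphere_critical_points_of_real[OF harmonic_polyD[OF h(1)]] by (simp only: h(2)[symmetric])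
  then show ?thesis using card_real_sphere_critical_points_le[OF h(1)] assms(2) by simp
qed

section \<open>An open dense set of harmonics with finitely many critical points\<close>

definition nondegenerate_harmonics :: "nat \<Rightarrow> (real ^ 3 \<Rightarrow> complex) set" where
  "nondegenerate_harmonics n = {u \<in> real_harmonic_polynomials n.
     no_common_zero n (restricted_coeff1 n (\<lambda>x. Re (u x))) (restricted_coeff2 n (\<lambda>x. Re (u x)))}"

lemma finite_sphere_critical_points_nondegenerate:
  assumes "u \<in> nondegenerate_harmonics n"
  shows "finite (sphere_critical_points u)"
proof -
  have u: "u \<in> real_harmonic_polynomials n" using assms by (simp add: nondegenerate_harmonics_def)
  note h = real_harmonic_polynomials_Re[OF u]
  obtain F G where "standard_chart n (\<lambda>x. Re (u x)) F G" using ex_standard_chart[OF h(1)] by blast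
  then interpret standard_chart n "\<lambda>x. Re (u x)" F G .
  have "sphere_critical_points u = real_sphere_critical_points (\<lambda>x. Re (u x))"
    using sphere_critical_points_of_real[OF harmonic_polyD[OF h(1)]] by (simp only: h(2)[symmetric])
  then show ?thesis
    using finite_critical_if_no_common_zero assms by (simp add: nondegenerate_harmonics_def)
qed

text \<open>The restricted coefficients are continuous in \<open>u\<close>, and having no common
  zero is stable under small changes of the coefficients.\<close>

lemma openin_nondegenerate_harmonics:
  "openin (top_of_set (real_harmonic_polynomials n)) (nondegenerate_harmonics n)"
proof (subst openin_subopen, intro ballI)
  fix u assume u: "u \<in> nondegenerate_harmonics n"
  let ?a = "\<lambda>u. restricted_coeff1 n (\<lambda>x. Re (u x))" and ?b = "\<lambda>u. restricted_coeff2 n (\<lambda>x. Re (u x))"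
  have "no_common_zero n (?a u) (?b u)" using u by (simp add: nondegenerate_harmonics_def)
  then obtain m where m: "m > 0" "\<And>a' b'. (\<Sum>k\<le>n. \<bar>?a u k - a' k\<bar>) + (\<Sum>k\<le>n. \<bar>?b u k - b' k\<bar>) < m \<Longrightarrow> no_common_zero n a' b'"
    using no_common_zero_open by metis
  define V where "V = {v. (\<Sum>k\<le>n. \<bar>?a u k - ?a v k\<bar>) + (\<Sum>k\<le>n. \<bar>?b u k - ?b v k\<bar>) < m}"
  have "open V"
    unfolding V_def
    by (intro open_Collect_less continuous_intros continuous_on_restricted_coeff)
  then have "openin (top_of_set (real_harmonic_polynomials n)) (real_harmonic_polynomials n \<inter> V)"
    by (rule openin_open_Int)
  moreover have "u \<in> real_harmonic_polynomials n \<inter> V"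
    using u m(1) by (simp add: V_def nondegenerate_harmonics_def)
  moreover have "real_harmonic_polynomials n \<inter> V \<subseteq> nondegenerate_harmonics n"
    using m(2) by (auto simp: V_def nondegenerate_harmonics_def)
  ultimately show "\<exists>T. openin (top_of_set (real_harmonic_polynomials n)) T \<and> u \<in> T \<and> T \<subseteq> nondegenerate_harmonics n"
    by blast
qed

text \<open>The line through \<open>u\<close> in the direction of \<open>generic_harmonic\<close>
  leaves the nondegenerate set for finitely many parameters only, while every neighbourhood of
  \<open>u\<close> contains infinitely many of its parameters.\<close>

lemma nondegenerate_harmonics_dense:
  assumes "n \<ge> 1"
  shows "top_of_set (real_harmonic_polynomials n) closure_of nondegenerate_harmonics n = real_harmonic_polynomials n"
proof (intro antisym subsetI)
  fix u assume "u \<in> top_of_set (real_harmonic_polynomials n) closure_of nondegenerate_harmonics n"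
  then show "u \<in> real_harmonic_polynomials n" by (simp add: in_closure_of)
next
  fix u assume u: "u \<in> real_harmonic_polynomials n"
  note h = real_harmonic_polynomials_Re[OF u]
  define v where "v = (\<lambda>x. Re (u x))"
  obtain m where n: "n = Suc m" using assms by (cases n) auto
  define w where "w = generic_harmonic m"
  have w: "harmonic_poly n w" unfolding n w_def by (rule harmonic_poly_generic_harmonic)
  define c where "c = (\<lambda>t x. complex_of_real (v x + t * w x))"
  have cH: "c t \<in> real_harmonic_polynomials n" for t
    unfolding c_def
    by (intro of_real_in_real_harmonic_polynomials harmonic_poly_add harmonic_poly_scale w) (use h(1) in \<open>simp add: v_def\<close>)
  have bad: "finite {t. c t \<notin> nondegenerate_harmonics n}"
  proof -
    have "(\<lambda>x. Re (c t x)) = (\<lambda>x. v x + t * w x)" for t by (simp add: c_def)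
    then have "{t. c t \<notin> nondegenerate_harmonics n} =
        {t. \<not> no_common_zero n (\<lambda>k. restricted_coeff1 n v k + t * restricted_coeff1 n w k)
            (\<lambda>k. restricted_coeff2 n v k + t * restricted_coeff2 n w k)}"
      using cH by (simp add: nondegenerate_harmonics_def restricted_coeff_add_scale[abs_def])
    then show ?thesis
      using finite_degenerate_parameters[OF generic_harmonic_nondegenerate, of m]
      by (simp add: n w_def)
  qed
  show "u \<in> top_of_set (real_harmonic_polynomials n) closure_of nondegenerate_harmonics n"
    unfolding in_closure_of
  proof (intro conjI allI impI)
    show "u \<in> topspace (top_of_set (real_harmonic_polynomials n))" using u by simp
    fix T assume "u \<in> T \<and> openin (top_of_set (real_harmonic_polynomials n)) T"
    then obtain O' where O': "open O'" "T = real_harmonic_polynomials n \<inter> O'" "u \<in> O'"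
      by (auto simp: openin_open)
    \<comment> \<open>In the topology of pointwise convergence this is continuity of
      \<open>t \<mapsto> c t x\<close> for each fixed x.\<close>
    have "continuous_on UNIV c"
      unfolding c_def by (intro continuous_on_coordinatewise_then_product continuous_intros)
    then have "open (c -` O')" using O'(1) by (simp add: continuous_on_open_vimage)
    moreover have "c 0 = u" using h(2) by (simp add: c_def v_def)
    then have "0 \<in> c -` O'" using O'(3) by simp
    ultimately obtain r where r: "r > 0" "ball 0 r \<subseteq> c -` O'"
      unfolding open_contains_ball by blast
    have "{0<..<r} \<subseteq> ball 0 r" by (auto simp: dist_norm)
    then have "{0<..<r} \<subseteq> c -` O'" using r(2) by (rule order.trans)
    then have "infinite (c -` O')" using infinite_Ioo[OF r(1)] finite_subset by blast
    then have "\<not> c -` O' \<subseteq> {t. c t \<notin> nondegenerate_harmonics n}" using bad finite_subset by blast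
    then obtain t where "c t \<in> O'" "c t \<in> nondegenerate_harmonics n" by auto
    then show "\<exists>y. y \<in> nondegenerate_harmonics n \<and> y \<in> T" using O'(2) cH by blast
  qed
qed

theorem corollary3:
  fixes n :: nat
  assumes "n \<ge> 1"
  shows "(\<forall>u \<in> real_harmonic_polynomials n.
            finite (sphere_critical_points u) \<longrightarrow> card (sphere_critical_points u) \<le> 2 * n\<^sup>2) \<and>
         holds_for_generic_real_harmonic n
           (\<lambda>u. finite (sphere_critical_points u) \<and> card (sphere_critical_points u) \<le> 2 * n\<^sup>2)"
proof
  show "\<forall>u \<in> real_harmonic_polynomials n.
            finite (sphere_critical_points u) \<longrightarrow> card (sphere_critical_points u) \<le> 2 * n\<^sup>2"
    using card_sphere_critical_points_le by blast
  \<comment> \<open>Finiteness is carried along because \<open>card\<close> of an infinite set is 0,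
    so the bound alone would not express it.\<close>
  have "\<forall>u\<in>nondegenerate_harmonics n. finite (sphere_critical_points u) \<and> card (sphere_critical_points u) \<le> 2 * n\<^sup>2"
    using finite_sphere_critical_points_nondegenerate card_sphere_critical_points_le
    by (auto simp: nondegenerate_harmonics_def)
  then show "holds_for_generic_real_harmonic n
           (\<lambda>u. finite (sphere_critical_points u) \<and> card (sphere_critical_points u) \<le> 2 * n\<^sup>2)"
    unfolding holds_for_generic_real_harmonic_def
    using openin_nondegenerate_harmonics nondegenerate_harmonics_dense[OF assms] by blast
qed

end
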